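(* Let $A$ be an operator on $\mathcal F_\lambda$ for which the complex Weyl symbol $W_0(A)$ is defined. For each $g\in G$ and $z\in\mathbb C^n$, we have $$W_0(\pi(g)^{-1}A\,\pi(g))(z)=W_0(A)(g\cdot z)$$ (for almost every $z$ if $A$ is a Hilbert-Schmidt operator whose symbol is only defined as an element of $L^2(\mathbb C^n,\mu_\lambda)$).
   Context: Fix integers $n,m\ge 1$ and $\lambda>0$. For $z,w\in\mathbb C^n$ put $zw:=\sum_k z_kw_k$ (bilinear), $|z|^2=z\bar z$, and $\omega((z,w),(z',w')):=\tfrac i2(zw'-z'w)$. Let $\alpha_1,\dots,\alpha_n$ be linear forms on $\mathbb R^m$; $t\cdot z=(e^{i\alpha_1(t)}z_1,\dots,e^{i\alpha_n(t)}z_n)$ for $t\in\mathbb R^m$; $t^{-1}$ means $-t$. The generalized diamond group $G$ is $\mathbb R^m\times\mathbb C^n\times\mathbb R$ with $(t,z,c)\cdot(t',z',c')=(t+t',\,z+t\cdot z',\,c+c'+\tfrac12\omega((z,\bar z),(t\cdot z',\overline{t\cdot z'})))$. It acts on $\mathbb C^n$ by $(t,z_0,c_0)\cdot z=t\cdot z+z_0$. $\mathcal F_\lambda$ is the Hilbert space of holomorphic $f$ on $\mathbb C^n$ with $\int_{\mathbb C^n}|f(z)|^2e^{-\lambda|z|^2/2}d\mu_\lambda(z)<\infty$, $d\mu_\lambda=(2\pi)^{-n}\lambda^n\,dx\,dy$, $z=x+iy$. Fix a unitary character $\chi$ of $\mathbb R^m$; the unitary representation $\pi$ of $G$ on $\mathcal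 F_\lambda$ is $(\pi(t,z_0,c_0)f)(z)=\chi(t)\exp(i\lambda c_0+\tfrac\lambda2\bar z_0z-\tfrac\lambda4|z_0|^2)f(t^{-1}\cdot(z-z_0))$. Coherent states: $e_z(w)=\exp(\lambda\bar zw/2)$. The kernel of an operator $A$ (with domain containing the coherent states) is $k_A(z,w)=\langle Ae_w,e_z\rangle$. Complex Weyl symbol: for $A$ trace class, $W_0(A)(z)=\mathrm{Tr}(A\,\Omega_0(z))$ with $(\Omega_0(z)f)(w)=2^n\exp(\lambda(w\bar z-|z|^2))f(2z-w)$; equivalently (known) $$W_0(A)(z)=2^n\int_{\mathbb C^n}k_A(z+w,z-w)\exp\left(\tfrac\lambda2(-z\bar z-w\bar w+z\bar w-\bar zw)\right)d\mu_\lambda(w).$$ This integral formula defines $W_0(A)(z)$ for every (not necessarily trace class) operator $A$ for which the integral converges absolutely for every $z$; on Hilbert-Schmidt operators, $W_0$ is the (known) unitary map $\mathcal L_2(\mathcal F_\lambda)\to L^2(\mathbb C^n,\mu_\lambda)$ extending $W_0$ continuously from trace class operators. *)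

theory Defs
  imports "HOL-Analysis.Analysis"
begin

section \<open>The generalized diamond group\<close>

text \<open>The dimensions n and m are the cardinalities of the index types \<^typ>\<open>'n\<close> and \<^typ>\<open>'m\<close>.
  Note that \<open>cdot\<close> is bilinear, not sesquilinear.\<close>

definition cdot :: "complex^'n \<Rightarrow> complex^'n \<Rightarrow> complex" where
  "cdot z w = (\<Sum>k\<in>UNIV. z $ k * w $ k)"

definition vcnj :: "complex^'n \<Rightarrow> complex^'n" where
  "vcnj z = (\<chi> k. cnj (z $ k))"

definition omega :: "(complex^'n) \<times> (complex^'n) \<Rightarrow> (complex^'n) \<times> (complex^'n) \<Rightarrow> complex" where
  "omega p q = \<i> / 2 * (cdot (fst p) (snd q) - cdot (fst q) (snd p))"

definition torus_act ::
  "('n::finite \<Rightarrow> real^'m::finite \<Rightarrow> real) \<Rightarrow> real^'m \<Rightarrow> complex^'n \<Rightarrow> complex^'n" where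
  "torus_act \<alpha> t z = (\<chi> k. exp (\<i> * complex_of_real (\<alpha> k t)) * z $ k)"

type_synonym ('m, 'n) diamond = "(real^'m) \<times> (complex^'n) \<times> real"

text \<open>The value of \<open>omega\<close> below is real (\<open>omega_real\<close>), so that taking the real part only
  changes its type.\<close>

definition diamond_mult ::
  "('n::finite \<Rightarrow> real^'m::finite \<Rightarrow> real) \<Rightarrow> ('m, 'n) diamond \<Rightarrow> ('m, 'n) diamond \<Rightarrow> ('m, 'n) diamond" where
  "diamond_mult \<alpha> = (\<lambda>(t, z, c) (t', z', c').
     (t + t', z + torus_act \<alpha> t z',
      c + c' + Re (omega (z, vcnj z) (torus_act \<alpha> t z', vcnj (torus_act \<alpha> t z'))) / 2))"

definition diamond_act ::
  "('n::finite \<Rightarrow> real^'m::finite \<Rightarrow> real) \<Rightarrow> ('m, 'n) diamond \<Rightarrow> complex^'n \<Rightarrow> complex^'n" where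
  "diamond_act \<alpha> = (\<lambda>(t, z0, c0) z. torus_act \<alpha> t z + z0)"

definition unitary_character :: "(real^'m \<Rightarrow> complex) \<Rightarrow> bool" where
  "unitary_character chi \<longleftrightarrow>
     continuous_on UNIV chi \<and> (\<forall>t. norm (chi t) = 1) \<and> (\<forall>s t. chi (s + t) = chi s * chi t)"


section \<open>The Fock space\<close>

definition holomorphic_Cn :: "(complex^'n \<Rightarrow> complex) \<Rightarrow> bool" where
  "holomorphic_Cn f \<longleftrightarrow>
     (\<forall>z. \<exists>D. (f has_derivative D) (at z) \<and> (\<forall>c v. D (c *s v) = c * D v))"

definition mu :: "real \<Rightarrow> (complex^'n) measure" where
  "mu lam = density lborel (\<lambda>_. ennreal ((lam / (2 * pi)) ^ CARD('n)))"

text \<open>Elements of the Fock space are honest functions, not classes modulo null sets.\<close>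

definition fock :: "real \<Rightarrow> (complex^'n \<Rightarrow> complex) set" where
  "fock lam = {f. holomorphic_Cn f \<and>
     integrable (mu lam) (\<lambda>z. (norm (f z))\<^sup>2 * exp (- lam * (norm z)\<^sup>2 / 2))}"

definition fock_inner ::
  "real \<Rightarrow> (complex^'n \<Rightarrow> complex) \<Rightarrow> (complex^'n \<Rightarrow> complex) \<Rightarrow> complex" where
  "fock_inner lam f h =
     (LINT z|mu lam. f z * cnj (h z) * complex_of_real (exp (- lam * (norm z)\<^sup>2 / 2)))"

definition fock_norm :: "real \<Rightarrow> (complex^'n \<Rightarrow> complex) \<Rightarrow> real" where
  "fock_norm lam f = sqrt (Re (fock_inner lam f f))"

definition coherent :: "real \<Rightarrow> complex^'n \<Rightarrow> complex^'n \<Rightarrow> complex" where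
  "coherent lam z w = exp (complex_of_real lam * cdot (vcnj z) w / 2)"

definition diamond_rep ::
  "real \<Rightarrow> ('n::finite \<Rightarrow> real^'m::finite \<Rightarrow> real) \<Rightarrow> (real^'m \<Rightarrow> complex) \<Rightarrow> ('m, 'n) diamond \<Rightarrow>
     (complex^'n \<Rightarrow> complex) \<Rightarrow> complex^'n \<Rightarrow> complex" where
  "diamond_rep lam \<alpha> chi = (\<lambda>(t, z0, c0) f z.
     chi t *
     exp (\<i> * complex_of_real lam * complex_of_real c0
          + complex_of_real lam / 2 * cdot (vcnj z0) z
          - complex_of_real lam / 4 * complex_of_real ((norm z0)\<^sup>2)) *
     f (torus_act \<alpha> (- t) (z - z0)))"


section \<open>Operators on the Fock space\<close>

text \<open>An operator is given by a function on all of \<^typ>\<open>complex^'n \<Rightarrow> complex\<close> of which only the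
  values on its domain matter; the domain is a subspace of the Fock space, not
  necessarily closed or dense.\<close>

definition fock_operator ::
  "real \<Rightarrow> (complex^'n \<Rightarrow> complex) set \<Rightarrow>
     ((complex^'n \<Rightarrow> complex) \<Rightarrow> complex^'n \<Rightarrow> complex) \<Rightarrow> bool" where
  "fock_operator lam D A \<longleftrightarrow>
     D \<subseteq> fock lam \<and> (\<lambda>_. 0) \<in> D \<and>
     (\<forall>f\<in>D. \<forall>h\<in>D. (\<lambda>z. f z + h z) \<in> D) \<and> (\<forall>c. \<forall>f\<in>D. (\<lambda>z. c * f z) \<in> D) \<and>
     (\<forall>f\<in>D. A f \<in> fock lam) \<and>
     (\<forall>f\<in>D. \<forall>h\<in>D. A (\<lambda>z. f z + h z) = (\<lambda>z. A f z + A h z)) \<and>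
     (\<forall>c. \<forall>f\<in>D. A (\<lambda>z. c * f z) = (\<lambda>z. c * A f z))"

definition orthonormal_basis :: "real \<Rightarrow> (complex^'n \<Rightarrow> complex) set \<Rightarrow> bool" where
  "orthonormal_basis lam E \<longleftrightarrow>
     E \<subseteq> fock lam \<and>
     (\<forall>e\<in>E. \<forall>e'\<in>E. fock_inner lam e e' = (if e = e' then 1 else 0)) \<and>
     (\<forall>f\<in>fock lam. \<forall>\<epsilon>>0. \<exists>S c. finite S \<and> S \<subseteq> E \<and>
        fock_norm lam (\<lambda>z. f z - (\<Sum>e\<in>S. c e * e z)) < \<epsilon>)"

definition hilbert_schmidt ::
  "real \<Rightarrow> ((complex^'n \<Rightarrow> complex) \<Rightarrow> complex^'n \<Rightarrow> complex) \<Rightarrow> bool" where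
  "hilbert_schmidt lam A \<longleftrightarrow>
     fock_operator lam (fock lam) A \<and>
     (\<exists>K. \<forall>f\<in>fock lam. fock_norm lam (A f) \<le> K * fock_norm lam f) \<and>
     (\<exists>E. orthonormal_basis lam E \<and> (\<lambda>e. (fock_norm lam (A e))\<^sup>2) summable_on E)"

definition hs_norm ::
  "real \<Rightarrow> ((complex^'n \<Rightarrow> complex) \<Rightarrow> complex^'n \<Rightarrow> complex) \<Rightarrow> real" where
  "hs_norm lam A =
     sqrt (THE s. \<forall>E. orthonormal_basis lam E \<longrightarrow>
       ((\<lambda>e. (fock_norm lam (A e))\<^sup>2) has_sum s) E)"

text \<open>The trace class is the set of products of two Hilbert--Schmidt operators.\<close>

definition trace_class ::
  "real \<Rightarrow> ((complex^'n \<Rightarrow> complex) \<Rightarrow> complex^'n \<Rightarrow> complex) \<Rightarrow> bool" where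
  "trace_class lam A \<longleftrightarrow>
     (\<exists>B C. hilbert_schmidt lam B \<and> hilbert_schmidt lam C \<and> (\<forall>f\<in>fock lam. A f = B (C f)))"

definition op_trace ::
  "real \<Rightarrow> ((complex^'n \<Rightarrow> complex) \<Rightarrow> complex^'n \<Rightarrow> complex) \<Rightarrow> complex" where
  "op_trace lam A =
     (THE s. \<forall>E. orthonormal_basis lam E \<longrightarrow> ((\<lambda>e. fock_inner lam (A e) e) has_sum s) E)"

text \<open>The operator inverse is formed on the Fock space: \<open>conj_op\<close> maps \<open>A\<close> to
  \<open>\<pi>(g)\<inverse> A \<pi>(g)\<close>, whose natural domain is \<open>conj_dom\<close> of the domain of \<open>A\<close>.\<close>

definition conj_op ::
  "real \<Rightarrow> ('n::finite \<Rightarrow> real^'m::finite \<Rightarrow> real) \<Rightarrow> (real^'m \<Rightarrow> complex) \<Rightarrow> ('m, 'n) diamond \<Rightarrow>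
     ((complex^'n \<Rightarrow> complex) \<Rightarrow> complex^'n \<Rightarrow> complex) \<Rightarrow>
     (complex^'n \<Rightarrow> complex) \<Rightarrow> complex^'n \<Rightarrow> complex" where
  "conj_op lam \<alpha> chi g A =
     (\<lambda>f. inv_into (fock lam) (diamond_rep lam \<alpha> chi g) (A (diamond_rep lam \<alpha> chi g f)))"

definition conj_dom ::
  "real \<Rightarrow> ('n::finite \<Rightarrow> real^'m::finite \<Rightarrow> real) \<Rightarrow> (real^'m \<Rightarrow> complex) \<Rightarrow> ('m, 'n) diamond \<Rightarrow>
     (complex^'n \<Rightarrow> complex) set \<Rightarrow> (complex^'n \<Rightarrow> complex) set" where
  "conj_dom lam \<alpha> chi g D = {f \<in> fock lam. diamond_rep lam \<alpha> chi g f \<in> D}"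


section \<open>The complex Weyl symbol\<close>

definition kernel ::
  "real \<Rightarrow> ((complex^'n \<Rightarrow> complex) \<Rightarrow> complex^'n \<Rightarrow> complex) \<Rightarrow>
     complex^'n \<Rightarrow> complex^'n \<Rightarrow> complex" where
  "kernel lam A z w = fock_inner lam (A (coherent lam w)) (coherent lam z)"

subsection \<open>Trace class operators\<close>

definition Omega0 ::
  "real \<Rightarrow> complex^'n \<Rightarrow> (complex^'n \<Rightarrow> complex) \<Rightarrow> complex^'n \<Rightarrow> complex" where
  "Omega0 lam z f w =
     2 ^ CARD('n) *
     exp (complex_of_real lam * (cdot w (vcnj z) - complex_of_real ((norm z)\<^sup>2))) *
     f (2 *\<^sub>R z - w)"

definition weyl_trace ::
  "real \<Rightarrow> ((complex^'n \<Rightarrow> complex) \<Rightarrow> complex^'n \<Rightarrow> complex) \<Rightarrow> complex^'n \<Rightarrow> complex" where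
  "weyl_trace lam A z = op_trace lam (\<lambda>f. A (Omega0 lam z f))"

subsection \<open>Operators with absolutely convergent symbol integral\<close>

definition weyl_integrand ::
  "real \<Rightarrow> ((complex^'n \<Rightarrow> complex) \<Rightarrow> complex^'n \<Rightarrow> complex) \<Rightarrow>
     complex^'n \<Rightarrow> complex^'n \<Rightarrow> complex" where
  "weyl_integrand lam A z w =
     kernel lam A (z + w) (z - w) *
     exp (complex_of_real lam / 2 *
       (- cdot z (vcnj z) - cdot w (vcnj w) + cdot z (vcnj w) - cdot (vcnj z) w))"

text \<open>Absolute convergence is Lebesgue integrability, which includes measurability.\<close>

definition weyl_converges ::
  "real \<Rightarrow> (complex^'n \<Rightarrow> complex) set \<Rightarrow>
     ((complex^'n \<Rightarrow> complex) \<Rightarrow> complex^'n \<Rightarrow> complex) \<Rightarrow> bool" where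
  "weyl_converges lam D A \<longleftrightarrow>
     fock_operator lam D A \<and> (\<forall>w. coherent lam w \<in> D) \<and>
     (\<forall>z. integrable (mu lam) (weyl_integrand lam A z))"

definition weyl_integral ::
  "real \<Rightarrow> ((complex^'n \<Rightarrow> complex) \<Rightarrow> complex^'n \<Rightarrow> complex) \<Rightarrow> complex^'n \<Rightarrow> complex" where
  "weyl_integral lam A z = 2 ^ CARD('n) * (LINT w|mu lam. weyl_integrand lam A z w)"

subsection \<open>Hilbert--Schmidt operators\<close>

definition L2_mu :: "real \<Rightarrow> (complex^'n \<Rightarrow> complex) set" where
  "L2_mu lam = {F. F \<in> borel_measurable (mu lam) \<and> integrable (mu lam) (\<lambda>z. (norm (F z))\<^sup>2)}"

definition L2_mu_norm :: "real \<Rightarrow> (complex^'n \<Rightarrow> complex) \<Rightarrow> real" where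
  "L2_mu_norm lam F = sqrt (LINT z|mu lam. (norm (F z))\<^sup>2)"

text \<open>\<open>F\<close> represents the value at \<open>A\<close> of the continuous extension of \<open>weyl_trace\<close> from the
  trace class (with the Hilbert--Schmidt norm) to the Hilbert--Schmidt operators: the
  symbols of trace class operators tending to \<open>A\<close> tend to \<open>F\<close>.\<close>

definition is_weyl_L2 ::
  "real \<Rightarrow> ((complex^'n \<Rightarrow> complex) \<Rightarrow> complex^'n \<Rightarrow> complex) \<Rightarrow> (complex^'n \<Rightarrow> complex) \<Rightarrow> bool"
  where
  "is_weyl_L2 lam A F \<longleftrightarrow>
     F \<in> L2_mu lam \<and>
     (\<forall>T. (\<forall>k::nat. trace_class lam (T k)) \<and>
          (\<lambda>k. hs_norm lam (\<lambda>f z. T k f z - A f z)) \<longlonglongrightarrow> 0 \<longrightarrow>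
          (\<forall>k. weyl_trace lam (T k) \<in> L2_mu lam) \<and>
          (\<lambda>k. L2_mu_norm lam (\<lambda>z. weyl_trace lam (T k) z - F z)) \<longlonglongrightarrow> 0)"

text \<open>A representative of the symbol of a Hilbert--Schmidt operator, determined up to a null
  set. The extension of \<open>weyl_trace\<close> is a unitary map from the Hilbert--Schmidt operators onto
  \<open>L\<^sup>2\<close>, so the value 0 in the second case is only a convention making the function total.\<close>

definition weyl_L2 ::
  "real \<Rightarrow> ((complex^'n \<Rightarrow> complex) \<Rightarrow> complex^'n \<Rightarrow> complex) \<Rightarrow> complex^'n \<Rightarrow> complex" where
  "weyl_L2 lam A = (if \<exists>F. is_weyl_L2 lam A F then SOME F. is_weyl_L2 lam A F else (\<lambda>_. 0))"


section \<open>Consistency of the conventions\<close>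

lemma cdot_vcnj: "cdot z (vcnj z) = complex_of_real ((norm z)\<^sup>2)"
  by (simp add: cdot_def vcnj_def norm_vec_def L2_set_def real_sqrt_pow2 sum_nonneg
      complex_norm_square del: of_real_power)

lemma cdot_commute: "cdot z w = cdot w z"
  by (simp add: cdot_def mult.commute)

lemma omega_real: "Im (omega (z, vcnj z) (w, vcnj w)) = 0"
  by (simp add: omega_def cdot_def vcnj_def sum_subtractf [symmetric] algebra_simps)

lemma torus_act_add:
  assumes "\<And>k. linear (\<alpha> k)"
  shows "torus_act \<alpha> (s + t) z = torus_act \<alpha> s (torus_act \<alpha> t z)"
  by (simp add: torus_act_def vec_eq_iff linear_add [OF assms] distrib_left exp_add mult.assoc)

lemma torus_act_plus: "torus_act \<alpha> t (z + w) = torus_act \<alpha> t z + torus_act \<alpha> t w"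
  by (simp add: torus_act_def vec_eq_iff distrib_left)

lemma torus_act_minus: "torus_act \<alpha> t (z - w) = torus_act \<alpha> t z - torus_act \<alpha> t w"
  by (simp add: torus_act_def vec_eq_iff right_diff_distrib)

lemma torus_act_0:
  assumes "\<And>k. linear (\<alpha> k)"
  shows "torus_act \<alpha> 0 z = z"
  by (simp add: torus_act_def vec_eq_iff linear_0 [OF assms])

lemma diamond_act_mult:
  assumes "\<And>k. linear (\<alpha> k)"
  shows "diamond_act \<alpha> (diamond_mult \<alpha> g h) z = diamond_act \<alpha> g (diamond_act \<alpha> h z)"
  by (cases g; cases h)
    (simp add: diamond_act_def diamond_mult_def torus_act_add [OF assms] torus_act_plus)

lemma cdot_torus_act:
  assumes "\<And>k. linear (\<alpha> k)"
  shows "cdot (vcnj w) (torus_act \<alpha> (- t) z) = cdot (vcnj (torus_act \<alpha> t w)) z"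
  by (simp add: cdot_def vcnj_def torus_act_def linear_neg [OF assms] exp_cnj mult_ac)

lemma cdot_add_left: "cdot (x + y) w = cdot x w + cdot y w"
  by (simp add: cdot_def distrib_right sum.distrib)

lemma cdot_add_right: "cdot w (x + y) = cdot w x + cdot w y"
  by (simp add: cdot_def distrib_left sum.distrib)

lemma cdot_diff_right: "cdot w (x - y) = cdot w x - cdot w y"
  by (simp add: cdot_def right_diff_distrib sum_subtractf)

lemma vcnj_add: "vcnj (x + y) = vcnj x + vcnj y"
  by (simp add: vcnj_def vec_eq_iff)

lemma norm_torus_act: "norm (torus_act \<alpha> t z) = norm z"
  by (simp add: torus_act_def norm_vec_def norm_mult)

lemma diamond_rep_mult:
  assumes lin: "\<And>k. linear (\<alpha> k)" and chi: "unitary_character chi"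
  shows "diamond_rep lam \<alpha> chi (diamond_mult \<alpha> g h) f =
    diamond_rep lam \<alpha> chi g (diamond_rep lam \<alpha> chi h f)"
proof
  fix z
  obtain t a c where g: "g = (t, a, c)" by (cases g)
  obtain s b d where h: "h = (s, b, d)" by (cases h)
  define b' where "b' = torus_act \<alpha> t b"
  define r where "r = Re (omega (a, vcnj a) (b', vcnj b'))"
  have r: "complex_of_real r = \<i> / 2 * (cdot a (vcnj b') - cdot b' (vcnj a))"
    using omega_real [of a b'] by (simp add: r_def complex_eq_iff omega_def)
  have nrm: "complex_of_real ((norm (a + b'))\<^sup>2) =
      of_real ((norm a)\<^sup>2) + of_real ((norm b')\<^sup>2) + cdot a (vcnj b') + cdot b' (vcnj a)"
    by (simp only: cdot_vcnj [symmetric] vcnj_add cdot_add_left cdot_add_right ac_simps)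
  have arg: "torus_act \<alpha> (- (t + s)) (z - (a + b')) =
      torus_act \<alpha> (- s) (torus_act \<alpha> (- t) (z - a) - b)"
  proof -
    have "torus_act \<alpha> (- t) b' = b"
      by (simp add: b'_def torus_act_add [OF lin, symmetric] torus_act_0 [OF lin])
    moreover have "- (t + s) = (- s) + (- t)" by simp
    ultimately show ?thesis
      by (simp only: torus_act_add [OF lin] diff_diff_eq [symmetric] torus_act_minus [of _ "- t" "z - a"])
  qed
  have nb: "norm b' = norm b" by (simp add: b'_def norm_torus_act)
  let ?l = "complex_of_real lam"
  have ex: "\<i> * ?l * complex_of_real (c + d + r / 2) + ?l / 2 * cdot (vcnj (a + b')) z
        - ?l / 4 * complex_of_real ((norm (a + b'))\<^sup>2) =
      (\<i> * ?l * complex_of_real c + ?l / 2 * cdot (vcnj a) z - ?l / 4 * complex_of_real ((norm a)\<^sup>2))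
      + (\<i> * ?l * complex_of_real d + ?l / 2 * cdot (vcnj b) (torus_act \<alpha> (- t) (z - a))
        - ?l / 4 * complex_of_real ((norm b)\<^sup>2))"
    unfolding cdot_torus_act [OF lin] b'_def [symmetric] nrm vcnj_add cdot_add_left cdot_diff_right
      of_real_add of_real_divide r nb cdot_commute [of "vcnj b'" a]
    by (simp add: field_simps)
  have "chi (t + s) = chi t * chi s"
    using chi by (simp add: unitary_character_def)
  then show "diamond_rep lam \<alpha> chi (diamond_mult \<alpha> g h) f z =
      diamond_rep lam \<alpha> chi g (diamond_rep lam \<alpha> chi h f) z"
    unfolding g h diamond_rep_def diamond_mult_def prod.case b'_def [symmetric] r_def [symmetric]
      ex exp_add arg by (simp add: mult_ac)
qed

end

theory Submission
  imports Defs
begin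

text \<open>Conjugation by \<open>\<pi>(g)\<close> only moves the objects from which the symbol is built:
  \<open>\<pi>(g) e\<^sub>w\<close> is a multiple of the coherent state at \<open>g \<cdot> w\<close>, and \<open>\<pi>(g) \<Omega>\<^sub>0(z) = \<Omega>\<^sub>0(g \<cdot> z) \<pi>(g)\<close>.
  Hence the integrand of the symbol of \<open>\<pi>(g)\<inverse> A \<pi>(g)\<close> at \<open>(z, w)\<close> is that of \<open>A\<close> at
  \<open>(g \<cdot> z, t \<cdot> w)\<close>, and \<open>w \<mapsto> t \<cdot> w\<close> preserves \<open>\<mu>\<close>. For the trace and the
  Hilbert--Schmidt norm it suffices that \<open>\<pi>(g)\<close> permutes the orthonormal bases. The defining
  property of the \<open>L\<^sup>2\<close> symbol is therefore transported by \<open>g\<close>; it determines the symbol almost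
  everywhere because finite rank operators approximate every Hilbert--Schmidt operator.\<close>

section \<open>Invariance of Lebesgue measure under orthogonal maps\<close>

text \<open>The delicate point is uniqueness of the square-integrable symbol, not covariance.
  \<open>is_weyl_L2\<close> quantifies over trace class sequences that converge in
  \<open>hs_norm\<close>, so it pins the symbol down only if such a sequence exists; and convergence
  can be checked only once the description in \<open>hs_norm\<close> is known to denote the sum over
  one chosen basis. Independence of the basis is usually proved with the adjoint A*. Here the number
  |A* k|^2 is replaced by the squared norm of the functional f -> <A f, k>, which every orthonormal
  basis computes. This is why the section on bases is written for bounded functionals rather than
  for vectors. Invariance of \<open>op_trace\<close> and \<open>hs_norm\<close>, by contrast, is an
  equality of the predicates under the descriptions, whatever these denote. The constants lambda/2
  and lambda/4 in the representation complete the square in the Gaussian weight. This gives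
  unitarity, and the same completion of the square moves the Gaussian of the symbol integral from z
  to the translated point.\<close>

lemma nn_integral_lborel_reflect:
  fixes v :: "'a::euclidean_space"
  assumes [measurable]: "f \<in> borel_measurable borel"
  shows "(\<integral>\<^sup>+x. f (v - x) \<partial>lborel) = (\<integral>\<^sup>+x. f x \<partial>lborel)"
proof -
  have "(\<integral>\<^sup>+x. f x \<partial>lborel) =
      (\<integral>\<^sup>+x. f x \<partial>density (distr lborel borel (\<lambda>x. v + (- 1) *\<^sub>R x)) (\<lambda>_. 1))"
    using lborel_affine [of "- 1" v] by simp
  also have "\<dots> = (\<integral>\<^sup>+x. f (v - x) \<partial>lborel)"
    by (simp add: nn_integral_density nn_integral_distr)
  finally show ?thesis by simp
qed

lemma nn_integral_lborel_translate:
  fixes v :: "'a::euclidean_space"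
  assumes [measurable]: "f \<in> borel_measurable borel"
  shows "(\<integral>\<^sup>+x. f (x - v) \<partial>lborel) = (\<integral>\<^sup>+x. f x \<partial>lborel)"
proof -
  have "(\<integral>\<^sup>+x. f x \<partial>lborel) = (\<integral>\<^sup>+x. f x \<partial>distr lborel borel ((+) (- v)))"
    by (simp add: lborel_distr_plus)
  also have "\<dots> = (\<integral>\<^sup>+x. f (x - v) \<partial>lborel)"
    by (simp add: nn_integral_distr)
  finally show ?thesis by simp
qed

text \<open>Uniqueness of Haar measure in miniature: integrating \<open>indicator A x * indicator (ball 0 1) (T y - x)\<close>
  in both orders gives the product of the image measure of the one set and Lebesgue measure of
  the other; the ball has the same finite nonzero value under both measures.\<close>

lemma distr_lborel_orthogonal:
  fixes T :: "'a::euclidean_space \<Rightarrow> 'a"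
  assumes T: "orthogonal_transformation T"
  shows "distr lborel borel T = lborel"
proof (rule measure_eqI)
  show "sets (distr lborel borel T) = sets lborel" by simp
next
  fix A assume "A \<in> sets (distr lborel borel T)"
  then have A [measurable]: "A \<in> sets borel" by simp
  have lin: "linear T" and nrm: "\<And>x. norm (T x) = norm x"
    using T by (auto simp: orthogonal_transformation)
  have [measurable]: "T \<in> borel_measurable borel"
    using lin by (simp add: borel_measurable_continuous_onI linear_continuous_on linear_linear)
  define B :: "'a set" where "B = ball 0 1"
  have [measurable]: "B \<in> sets borel" by (simp add: B_def)
  have TB: "indicator B (T x) = (indicator B x :: ennreal)" for x
    by (simp add: B_def indicator_def nrm)
  have TA: "(\<integral>\<^sup>+y. indicator A (T y) \<partial>lborel) = emeasure (distr lborel borel T) A"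
    by (simp flip: nn_integral_indicator add: nn_integral_distr)
  let ?I = "\<lambda>x y. indicator A x * indicator B (T y - x) :: ennreal"
  have one: "(\<integral>\<^sup>+y. ?I x y \<partial>lborel) = indicator A x * emeasure lborel B" for x
  proof -
    obtain x' where x': "x = T x'"
      using orthogonal_transformation_surj [OF T] by blast
    have "(\<integral>\<^sup>+y. ?I x y \<partial>lborel) = indicator A x * (\<integral>\<^sup>+y. indicator B (T y - x) \<partial>lborel)"
      by (rule nn_integral_cmult) simp
    also have "(\<integral>\<^sup>+y. indicator B (T y - x) \<partial>lborel) = (\<integral>\<^sup>+y. indicator B (y - x') \<partial>lborel)"
      by (simp add: x' TB linear_diff [OF lin, symmetric])
    also have "\<dots> = emeasure lborel B"
      by (subst nn_integral_lborel_translate) auto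
    finally show ?thesis .
  qed
  \<comment> \<open>The reflection of x into \<open>T y - x\<close> swaps the arguments of the two
    indicators, so that \<open>T\<close> now acts on the side of \<open>A\<close>.\<close>
  have two: "(\<integral>\<^sup>+x. ?I x y \<partial>lborel) = (\<integral>\<^sup>+x. indicator A (T y - x) * indicator B x \<partial>lborel)" for y
    using nn_integral_lborel_reflect [of "\<lambda>x. ?I x y" "T y"] by simp
  have three: "(\<integral>\<^sup>+y. indicator A (T y - x) * indicator B x \<partial>lborel) =
      emeasure (distr lborel borel T) A * indicator B x" for x
  proof -
    obtain x' where x': "x = T x'"
      using orthogonal_transformation_surj [OF T] by blast
    have "(\<integral>\<^sup>+y. indicator A (T y - x) * indicator B x \<partial>lborel) =
        (\<integral>\<^sup>+y. indicator A (T (y - x')) \<partial>lborel) * indicator B x"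
      by (subst nn_integral_multc) (simp_all add: x' linear_diff [OF lin])
    also have "(\<integral>\<^sup>+y. indicator A (T (y - x')) \<partial>lborel) = (\<integral>\<^sup>+y. indicator A (T y) \<partial>lborel)"
      by (rule nn_integral_lborel_translate) simp
    finally show ?thesis by (simp add: TA)
  qed
  have "emeasure lborel A * emeasure lborel B = (\<integral>\<^sup>+x. (\<integral>\<^sup>+y. ?I x y \<partial>lborel) \<partial>lborel)"
    by (simp add: one nn_integral_multc)
  also have "\<dots> = (\<integral>\<^sup>+y. (\<integral>\<^sup>+x. ?I x y \<partial>lborel) \<partial>lborel)"
    by (rule lborel_pair.Fubini') simp
  also have "\<dots> = (\<integral>\<^sup>+x. (\<integral>\<^sup>+y. indicator A (T y - x) * indicator B x \<partial>lborel) \<partial>lborel)"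
    unfolding two by (rule lborel_pair.Fubini') simp
  also have "\<dots> = emeasure (distr lborel borel T) A * emeasure lborel B"
    by (simp add: three nn_integral_cmult)
  finally have eq: "emeasure lborel A * emeasure lborel B =
      emeasure (distr lborel borel T) A * emeasure lborel B" .
  have "emeasure lborel B < \<infinity>"
    unfolding B_def by (rule emeasure_bounded_finite) simp
  moreover have "emeasure lborel B \<noteq> 0"
    using content_ball_pos [of 1 "0::'a"] by (auto simp: B_def measure_def)
  moreover have "emeasure lborel B * emeasure lborel A =
      emeasure lborel B * emeasure (distr lborel borel T) A"
    using eq by (simp only: mult.commute)
  ultimately show "emeasure (distr lborel borel T) A = emeasure lborel A"
    unfolding ennreal_mult_cancel_left by (metis less_irrefl infinity_ennreal_def)
qed

text \<open>The shape \<open>T (z - v)\<close> covers the argument shift inside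
  \<open>diamond_rep\<close>, the action of the group on points (through \<open>act_affine\<close>),
  and, with v = 0, the substitution in the symbol integral.\<close>

lemma distr_mu:
  fixes T :: "complex^'n \<Rightarrow> complex^'n"
  assumes "orthogonal_transformation T"
  shows "distr (mu lam) (mu lam) (\<lambda>z. T (z - v)) = mu lam"
proof -
  have [measurable]: "T \<in> borel_measurable borel"
    using assms by (simp add: orthogonal_transformation borel_measurable_continuous_onI
        linear_continuous_on linear_linear)
  have "distr lborel borel (\<lambda>z. T (z - v)) = distr (distr lborel borel ((+) (- v))) borel T"
    by (subst distr_distr) (auto simp: o_def)
  also have "\<dots> = lborel"
    by (simp add: lborel_distr_plus distr_lborel_orthogonal [OF assms])
  finally have *: "distr lborel borel (\<lambda>z. T (z - v)) = lborel" .
  have "distr (mu lam) borel (\<lambda>z. T (z - v)) =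
      density (distr lborel borel (\<lambda>z. T (z - v))) (\<lambda>_. ennreal ((lam / (2 * pi)) ^ CARD('n)))"
    by (subst density_distr) (auto simp: mu_def)
  then show ?thesis
    unfolding * by (simp add: mu_def cong: distr_cong)
qed

section \<open>Holomorphic functions and the Fock space\<close>

lemma borel_measurable_mu [simp]: "borel_measurable (mu lam) = borel_measurable borel"
  by (rule measurable_cong_sets) (simp_all add: mu_def)

lemma holomorphic_Cn_continuous: "holomorphic_Cn f \<Longrightarrow> continuous_on UNIV f"
  by (metis holomorphic_Cn_def has_derivative_continuous continuous_at_imp_continuous_on)

lemma holomorphic_Cn_measurable [measurable_dest]:
  "holomorphic_Cn f \<Longrightarrow> f \<in> borel_measurable borel"
  by (simp add: borel_measurable_continuous_onI holomorphic_Cn_continuous)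

lemma holomorphic_Cn_const: "holomorphic_Cn (\<lambda>_. c)"
  unfolding holomorphic_Cn_def by (intro allI exI [of _ "\<lambda>_. 0"]) simp

lemma holomorphic_Cn_add:
  assumes "holomorphic_Cn f" "holomorphic_Cn h"
  shows "holomorphic_Cn (\<lambda>z. f z + h z)"
  unfolding holomorphic_Cn_def
proof
  fix z
  obtain D D' where "(f has_derivative D) (at z)" "\<And>c v. D (c *s v) = c * D v"
      "(h has_derivative D') (at z)" "\<And>c v. D' (c *s v) = c * D' v"
    using assms unfolding holomorphic_Cn_def by metis
  then show "\<exists>D. ((\<lambda>z. f z + h z) has_derivative D) (at z) \<and> (\<forall>c v. D (c *s v) = c * D v)"
    by (intro exI [of _ "\<lambda>v. D v + D' v"]) (auto intro!: derivative_intros simp: distrib_left)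
qed

lemma holomorphic_Cn_mult:
  assumes "holomorphic_Cn f" "holomorphic_Cn h"
  shows "holomorphic_Cn (\<lambda>z. f z * h z)"
  unfolding holomorphic_Cn_def
proof
  fix z
  obtain D D' where "(f has_derivative D) (at z)" "\<And>c v. D (c *s v) = c * D v"
      "(h has_derivative D') (at z)" "\<And>c v. D' (c *s v) = c * D' v"
    using assms unfolding holomorphic_Cn_def by metis
  then show "\<exists>D. ((\<lambda>z. f z * h z) has_derivative D) (at z) \<and> (\<forall>c v. D (c *s v) = c * D v)"
    by (intro exI [of _ "\<lambda>v. f z * D' v + D v * h z"] conjI has_derivative_mult)
      (simp_all add: algebra_simps)
qed

lemma bounded_linear_cdot: "bounded_linear (cdot a)"
  by (rule linear_conv_bounded_linear [THEN iffD1], rule linearI)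
    (simp_all add: cdot_def distrib_left sum.distrib scaleR_sum_right)

lemma cdot_scale: "cdot a (c *s v) = c * cdot a v"
  by (simp add: cdot_def sum_distrib_left mult_ac)

lemma holomorphic_Cn_exp_cdot: "holomorphic_Cn (\<lambda>z. exp (b + c * cdot a z))"
  unfolding holomorphic_Cn_def
proof
  fix z
  have "(cdot a has_derivative cdot a) (at z)"
    by (rule bounded_linear.has_derivative [OF bounded_linear_cdot]) (rule has_derivative_ident)
  from has_derivative_add [OF has_derivative_const has_derivative_mult_right [OF this]]
  have "((\<lambda>z. b + c * cdot a z) has_derivative (\<lambda>v. c * cdot a v)) (at z)" by simp
  from has_derivative_compose [OF this has_field_derivative_imp_has_derivative [OF DERIV_exp]]
  show "\<exists>D. ((\<lambda>z. exp (b + c * cdot a z)) has_derivative D) (at z) \<and>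
      (\<forall>c v. D (c *s v) = c * D v)"
    by (intro exI [of _ "\<lambda>v. exp (b + c * cdot a z) * (c * cdot a v)"]) (simp add: cdot_scale)
qed

text \<open>Complex homogeneity of \<open>R\<close> is what keeps the derivative
  \<open>D (R v)\<close> complex linear.\<close>

lemma holomorphic_Cn_compose_affine:
  assumes f: "holomorphic_Cn f" and R: "linear R" "\<And>c v. R (c *s v) = c *s R v"
  shows "holomorphic_Cn (\<lambda>z. f (R (z - v)))"
  unfolding holomorphic_Cn_def
proof
  fix z
  obtain D where D: "(f has_derivative D) (at (R (z - v)))" "\<And>c w. D (c *s w) = c * D w"
    using f unfolding holomorphic_Cn_def by metis
  have "bounded_linear R"
    using R(1) by (simp add: linear_conv_bounded_linear)
  from bounded_linear.has_derivative [OF this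
      has_derivative_diff [OF has_derivative_ident has_derivative_const]]
  have "((\<lambda>z. R (z - v)) has_derivative R) (at z)" by simp
  from has_derivative_compose [OF this D(1)]
  show "\<exists>D. ((\<lambda>z. f (R (z - v))) has_derivative D) (at z) \<and> (\<forall>c v. D (c *s v) = c * D v)"
    by (intro exI [of _ "\<lambda>v. D (R v)"]) (simp add: R(2) D(2))
qed

lemma fock_holomorphic: "f \<in> fock lam \<Longrightarrow> holomorphic_Cn f"
  by (simp add: fock_def)

lemma fock_measurable [measurable_dest]: "f \<in> fock lam \<Longrightarrow> f \<in> borel_measurable borel"
  by (intro holomorphic_Cn_measurable fock_holomorphic)

lemma fock_integrable:
  "f \<in> fock lam \<Longrightarrow> integrable (mu lam) (\<lambda>z. (norm (f z))\<^sup>2 * exp (- lam * (norm z)\<^sup>2 / 2))"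
  by (simp add: fock_def)

lemma borel_measurable_cnj [measurable (raw)]:
  "f \<in> borel_measurable M \<Longrightarrow> (\<lambda>x. cnj (f x)) \<in> borel_measurable M"
  by (erule measurable_compose) (intro borel_measurable_continuous_onI continuous_on_cnj continuous_on_id)

text \<open>Pointwise |f h| is at most |f|^2 + |h|^2, whose weighted integrals are finite.
  Additivity of \<open>fock_inner\<close> rests on this.\<close>

lemma fock_inner_integrable:
  assumes f: "f \<in> fock lam" and h: "h \<in> fock lam"
  shows "integrable (mu lam) (\<lambda>z. f z * cnj (h z) * complex_of_real (exp (- lam * (norm z)\<^sup>2 / 2)))"
proof (rule Bochner_Integration.integrable_bound [OF Bochner_Integration.integrable_add
      [OF fock_integrable [OF f] fock_integrable [OF h]]])
  note [measurable] = fock_measurable [OF f] fock_measurable [OF h]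
  show "(\<lambda>z. f z * cnj (h z) * complex_of_real (exp (- lam * (norm z)\<^sup>2 / 2)))
      \<in> borel_measurable (mu lam)"
    by simp
  show "AE z in mu lam. norm (f z * cnj (h z) * complex_of_real (exp (- lam * (norm z)\<^sup>2 / 2)))
      \<le> norm ((norm (f z))\<^sup>2 * exp (- lam * (norm z)\<^sup>2 / 2)
             + (norm (h z))\<^sup>2 * exp (- lam * (norm z)\<^sup>2 / 2))"
  proof (rule AE_I2)
    fix z
    have "norm (f z) * norm (h z) \<le> (norm (f z))\<^sup>2 + (norm (h z))\<^sup>2"
      using sum_squares_bound [of "norm (f z)" "norm (h z)"]
        mult_nonneg_nonneg [OF norm_ge_zero [of "f z"] norm_ge_zero [of "h z"]] by linarith
    then show "norm (f z * cnj (h z) * complex_of_real (exp (- lam * (norm z)\<^sup>2 / 2)))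
        \<le> norm ((norm (f z))\<^sup>2 * exp (- lam * (norm z)\<^sup>2 / 2)
             + (norm (h z))\<^sup>2 * exp (- lam * (norm z)\<^sup>2 / 2))"
      by (simp add: norm_mult flip: distrib_right)
  qed
qed

section \<open>The Fock space as a vector space\<close>

lemma fock_zero: "(\<lambda>_. 0) \<in> fock lam"
  by (simp add: fock_def holomorphic_Cn_const)

lemma fock_scale: "f \<in> fock lam \<Longrightarrow> (\<lambda>z. c * f z) \<in> fock lam"
  by (simp add: fock_def holomorphic_Cn_mult holomorphic_Cn_const norm_mult power_mult_distrib
      mult.assoc)

lemma fock_add:
  assumes f: "f \<in> fock lam" and h: "h \<in> fock lam"
  shows "(\<lambda>z. f z + h z) \<in> fock lam"
proof -
  note [measurable] = fock_measurable [OF f] fock_measurable [OF h]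
  have "integrable (mu lam) (\<lambda>z. (norm (f z + h z))\<^sup>2 * exp (- lam * (norm z)\<^sup>2 / 2))"
  proof (rule Bochner_Integration.integrable_bound [OF Bochner_Integration.integrable_add
        [OF integrable_mult_right [OF fock_integrable [OF f], of 2]
          integrable_mult_right [OF fock_integrable [OF h], of 2]]])
    show "(\<lambda>z. (norm (f z + h z))\<^sup>2 * exp (- lam * (norm z)\<^sup>2 / 2)) \<in> borel_measurable (mu lam)"
      by simp
    show "AE z in mu lam. norm ((norm (f z + h z))\<^sup>2 * exp (- lam * (norm z)\<^sup>2 / 2))
        \<le> norm (2 * ((norm (f z))\<^sup>2 * exp (- lam * (norm z)\<^sup>2 / 2))
               + 2 * ((norm (h z))\<^sup>2 * exp (- lam * (norm z)\<^sup>2 / 2)))"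
    proof (rule AE_I2)
      fix z
      have "(norm (f z + h z))\<^sup>2 \<le> (norm (f z) + norm (h z))\<^sup>2"
        by (intro power_mono norm_triangle_ineq norm_ge_zero)
      also have "\<dots> \<le> 2 * (norm (f z))\<^sup>2 + 2 * (norm (h z))\<^sup>2"
        using sum_squares_bound [of "norm (f z)" "norm (h z)"] by (simp add: power2_sum)
      finally show "norm ((norm (f z + h z))\<^sup>2 * exp (- lam * (norm z)\<^sup>2 / 2))
          \<le> norm (2 * ((norm (f z))\<^sup>2 * exp (- lam * (norm z)\<^sup>2 / 2))
               + 2 * ((norm (h z))\<^sup>2 * exp (- lam * (norm z)\<^sup>2 / 2)))"
        by (simp flip: distrib_right mult.assoc)
    qed
  qed
  then show ?thesis
    using f h by (simp add: fock_def holomorphic_Cn_add)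
qed

lemma fock_diff: "f \<in> fock lam \<Longrightarrow> h \<in> fock lam \<Longrightarrow> (\<lambda>z. f z - h z) \<in> fock lam"
  using fock_add [OF _ fock_scale, of f lam h "- 1"] by simp

lemma fock_sum:
  assumes "finite S" "S \<subseteq> fock lam"
  shows "(\<lambda>z. \<Sum>e\<in>S. c e * e z) \<in> fock lam"
  using assms by (induction S) (simp_all add: fock_zero fock_add fock_scale)

section \<open>The inner product and its norm\<close>

lemma fock_inner_add_left:
  assumes "f \<in> fock lam" "h \<in> fock lam" "k \<in> fock lam"
  shows "fock_inner lam (\<lambda>z. f z + h z) k = fock_inner lam f k + fock_inner lam h k"
  unfolding fock_inner_def
  by (simp only: distrib_right Bochner_Integration.integral_add
      [OF fock_inner_integrable [OF assms(1,3)] fock_inner_integrable [OF assms(2,3)]])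

lemma fock_inner_scale_left: "fock_inner lam (\<lambda>z. c * f z) h = c * fock_inner lam f h"
  by (simp add: fock_inner_def mult.assoc)

lemma fock_inner_commute: "fock_inner lam h f = cnj (fock_inner lam f h)"
  unfolding fock_inner_def
  by (subst Bochner_Integration.integral_cnj [symmetric], rule Bochner_Integration.integral_cong)
    (simp_all add: mult_ac)

lemma fock_inner_scale_right: "fock_inner lam f (\<lambda>z. c * h z) = cnj c * fock_inner lam f h"
  by (subst (1 2) fock_inner_commute) (simp add: fock_inner_scale_left)

lemma fock_inner_add_right:
  assumes "f \<in> fock lam" "h \<in> fock lam" "k \<in> fock lam"
  shows "fock_inner lam k (\<lambda>z. f z + h z) = fock_inner lam k f + fock_inner lam k h"
  by (subst (1 2 3) fock_inner_commute) (simp add: fock_inner_add_left assms)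

lemma fock_inner_sum_left:
  assumes "finite S" "S \<subseteq> fock lam" "h \<in> fock lam"
  shows "fock_inner lam (\<lambda>z. \<Sum>e\<in>S. c e * e z) h = (\<Sum>e\<in>S. c e * fock_inner lam e h)"
  using assms
proof (induction S)
  case empty
  then show ?case by (simp add: fock_inner_def)
next
  case (insert e S)
  then show ?case
    by (simp add: fock_inner_add_left fock_scale fock_sum fock_inner_scale_left)
qed

lemma mult_cnj_cmod: "z * cnj z = complex_of_real ((cmod z)\<^sup>2)"
  by (simp only: complex_norm_square)

text \<open>Valid for every function: the integrand is real and nonnegative, and a divergent
  integral has value 0, so the square root in \<open>fock_norm\<close> can always be undone.\<close>

lemma fock_inner_self: "fock_inner lam f f = complex_of_real ((fock_norm lam f)\<^sup>2)"
proof -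
  have "fock_inner lam f f =
      (LINT z|mu lam. complex_of_real ((norm (f z))\<^sup>2 * exp (- lam * (norm z)\<^sup>2 / 2)))"
    by (simp add: fock_inner_def mult_cnj_cmod)
  then have "fock_inner lam f f =
      complex_of_real (LINT z|mu lam. (norm (f z))\<^sup>2 * exp (- lam * (norm z)\<^sup>2 / 2))"
    by (simp only: integral_complex_of_real)
  then show ?thesis
    by (simp add: fock_norm_def del: of_real_power)
qed

lemma fock_norm_ge_0: "fock_norm lam f \<ge> 0"
proof -
  have "(fock_norm lam f)\<^sup>2 = Re (fock_inner lam f f)"
    by (simp add: fock_inner_self del: of_real_power)
  then have "Re (fock_inner lam f f) \<ge> 0" by (metis zero_le_power2)
  then show ?thesis by (simp add: fock_norm_def)
qed

lemma fock_norm_scale: "fock_norm lam (\<lambda>z. c * f z) = norm c * fock_norm lam f"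
proof -
  have "complex_of_real ((fock_norm lam (\<lambda>z. c * f z))\<^sup>2) =
      complex_of_real ((norm c * fock_norm lam f)\<^sup>2)"
    unfolding fock_inner_self [symmetric]
    by (simp add: fock_inner_scale_left fock_inner_scale_right fock_inner_self
        power_mult_distrib mult_cnj_cmod flip: mult.assoc)
  then show ?thesis
    by (simp add: fock_norm_ge_0 power2_eq_iff_nonneg del: of_real_power)
qed

lemma fock_norm_zero [simp]: "fock_norm lam (\<lambda>_. 0) = 0"
  by (simp add: fock_norm_def fock_inner_def)

lemma fock_norm_add_sq:
  assumes "f \<in> fock lam" "h \<in> fock lam"
  shows "(fock_norm lam (\<lambda>z. f z + h z))\<^sup>2 =
    (fock_norm lam f)\<^sup>2 + 2 * Re (fock_inner lam f h) + (fock_norm lam h)\<^sup>2"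
proof -
  have "(fock_norm lam (\<lambda>z. f z + h z))\<^sup>2 = Re (fock_inner lam (\<lambda>z. f z + h z) (\<lambda>z. f z + h z))"
    by (simp add: fock_inner_self del: of_real_power)
  also have "\<dots> = (fock_norm lam f)\<^sup>2 + Re (fock_inner lam f h) + Re (fock_inner lam h f)
      + (fock_norm lam h)\<^sup>2"
    by (simp only: fock_inner_add_left [OF assms fock_add [OF assms]]
        fock_inner_add_right [OF assms assms(1)] fock_inner_add_right [OF assms assms(2)])
      (simp add: fock_inner_self del: of_real_power)
  also have "Re (fock_inner lam h f) = Re (fock_inner lam f h)"
    by (subst fock_inner_commute) simp
  finally show ?thesis by simp
qed

text \<open>Positivity of the squared norm of f - t c h, with c = <f, h> and t real, is the
  quadratic inequality \<open>*\<close> in t. For b nonzero it is used at its minimiser t = 1 /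
  b^2.\<close>

lemma fock_Cauchy_Schwarz:
  assumes f: "f \<in> fock lam" and h: "h \<in> fock lam"
  shows "norm (fock_inner lam f h) \<le> fock_norm lam f * fock_norm lam h"
proof -
  define a b c where "a = fock_norm lam f" and "b = fock_norm lam h" and "c = fock_inner lam f h"
  have *: "2 * t * (norm c)\<^sup>2 \<le> a\<^sup>2 + t\<^sup>2 * (norm c)\<^sup>2 * b\<^sup>2" for t :: real
  proof -
    have "0 \<le> (fock_norm lam (\<lambda>z. f z + (- of_real t * c) * h z))\<^sup>2" by simp
    also have "\<dots> = a\<^sup>2 + 2 * Re (cnj (- of_real t * c) * c) + (norm (- of_real t * c) * b)\<^sup>2"
      by (simp only: fock_norm_add_sq [OF f fock_scale [OF h]] fock_inner_scale_right
          fock_norm_scale a_def b_def c_def)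
    also have "Re (cnj (- of_real t * c) * c) = - t * (norm c)\<^sup>2"
      by (simp add: cmod_power2) (simp add: power2_eq_square algebra_simps)
    also have "(norm (- of_real t * c) * b)\<^sup>2 = t\<^sup>2 * (norm c)\<^sup>2 * b\<^sup>2"
      by (simp add: norm_mult power_mult_distrib)
    finally show ?thesis by simp
  qed
  have "(norm c)\<^sup>2 \<le> a\<^sup>2 * b\<^sup>2"
  proof (cases "b = 0")
    case True
    have "norm c = 0"
    proof (rule ccontr)
      assume nz: "norm c \<noteq> 0"
      \<comment> \<open>With b = 0 the bound \<open>*\<close> is linear in t; this t makes its left
        side exceed the fixed right side.\<close>
      have "2 * (a\<^sup>2 + 1) \<le> a\<^sup>2"
        using * [of "(a\<^sup>2 + 1) / (norm c)\<^sup>2"] nz True by simp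
      then show False using zero_le_power2 [of a] by (simp add: distrib_left)
    qed
    then show ?thesis using True by simp
  next
    case False
    then have "(norm c)\<^sup>2 / b\<^sup>2 \<le> a\<^sup>2"
      using * [of "1 / b\<^sup>2"] by (simp add: power2_eq_square)
    then show ?thesis
      using False by (simp add: pos_divide_le_eq)
  qed
  then show ?thesis
    unfolding power_mult_distrib [symmetric] a_def b_def c_def
    by (rule power2_le_imp_le) (simp add: fock_norm_ge_0)
qed

lemma fock_norm_triangle:
  assumes f: "f \<in> fock lam" and h: "h \<in> fock lam"
  shows "fock_norm lam (\<lambda>z. f z + h z) \<le> fock_norm lam f + fock_norm lam h"
proof (rule power2_le_imp_le)
  have "Re (fock_inner lam f h) \<le> fock_norm lam f * fock_norm lam h"
    using fock_Cauchy_Schwarz [OF f h] complex_Re_le_cmod order_trans by blast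
  then show "(fock_norm lam (\<lambda>z. f z + h z))\<^sup>2 \<le> (fock_norm lam f + fock_norm lam h)\<^sup>2"
    by (simp add: fock_norm_add_sq [OF f h] power2_sum)
qed (simp add: fock_norm_ge_0)

lemma fock_norm_minus: "fock_norm lam (\<lambda>z. - f z) = fock_norm lam f"
  using fock_norm_scale [of lam "- 1" f] by simp

lemma fock_norm_triangle_diff:
  assumes f: "f \<in> fock lam" and h: "h \<in> fock lam"
  shows "fock_norm lam (\<lambda>z. f z - h z) \<le> fock_norm lam f + fock_norm lam h"
  using fock_norm_triangle [OF f fock_scale [OF h, of "- 1"]] fock_norm_minus [of lam h] by simp

section \<open>Orthonormal bases and the Hilbert--Schmidt norm\<close>

text \<open>The bound M is a parameter, so that a crude bound can later be replaced by a sharp one.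
  Two families are meant: f -> <f, k>, and f -> <A f, k> for a bounded operator A.\<close>

definition bounded_functional ::
  "real \<Rightarrow> real \<Rightarrow> ((complex^'n \<Rightarrow> complex) \<Rightarrow> complex) \<Rightarrow> bool" where
  "bounded_functional lam M \<phi> \<longleftrightarrow>
     (\<forall>f\<in>fock lam. \<forall>h\<in>fock lam. \<phi> (\<lambda>z. f z + h z) = \<phi> f + \<phi> h) \<and>
     (\<forall>c. \<forall>f\<in>fock lam. \<phi> (\<lambda>z. c * f z) = c * \<phi> f) \<and>
     (\<forall>f\<in>fock lam. norm (\<phi> f) \<le> M * fock_norm lam f)"

lemma bounded_functionalD:
  assumes "bounded_functional lam M \<phi>"
  shows "\<And>f h. f \<in> fock lam \<Longrightarrow> h \<in> fock lam \<Longrightarrow> \<phi> (\<lambda>z. f z + h z) = \<phi> f + \<phi> h"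
    and "\<And>c f. f \<in> fock lam \<Longrightarrow> \<phi> (\<lambda>z. c * f z) = c * \<phi> f"
    and "\<And>f. f \<in> fock lam \<Longrightarrow> norm (\<phi> f) \<le> M * fock_norm lam f"
  using assms unfolding bounded_functional_def by blast+

lemma bounded_functional_sum:
  assumes \<phi>: "bounded_functional lam M \<phi>" and "finite S" "S \<subseteq> fock lam"
  shows "\<phi> (\<lambda>z. \<Sum>e\<in>S. c e * e z) = (\<Sum>e\<in>S. c e * \<phi> e)"
  using assms(2,3)
proof (induction S)
  case empty
  show ?case
    using bounded_functionalD(2) [OF \<phi> fock_zero, of 0] by simp
next
  case (insert e S)
  then have "\<phi> (\<lambda>z. c e * e z + (\<Sum>e\<in>S. c e * e z)) = c e * \<phi> e + \<phi> (\<lambda>z. \<Sum>e\<in>S. c e * e z)"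
    by (simp add: bounded_functionalD(1) [OF \<phi> fock_scale fock_sum] bounded_functionalD(2) [OF \<phi>])
  then show ?case using insert by simp
qed

lemma bounded_functional_inner:
  assumes "k \<in> fock lam"
  shows "bounded_functional lam (fock_norm lam k) (\<lambda>f. fock_inner lam f k)"
  using assms fock_Cauchy_Schwarz [OF _ assms]
  by (simp add: bounded_functional_def fock_inner_add_left fock_inner_scale_left mult.commute)

lemma orthonormal_basisD:
  assumes "orthonormal_basis lam E"
  shows "E \<subseteq> fock lam"
    and "\<And>e e'. e \<in> E \<Longrightarrow> e' \<in> E \<Longrightarrow> fock_inner lam e e' = (if e = e' then 1 else 0)"
    and "\<And>f \<epsilon>. f \<in> fock lam \<Longrightarrow> \<epsilon> > 0 \<Longrightarrow>
      \<exists>S c. finite S \<and> S \<subseteq> E \<and> fock_norm lam (\<lambda>z. f z - (\<Sum>e\<in>S. c e * e z)) < \<epsilon>"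
  using assms by (auto simp: orthonormal_basis_def)

lemma fock_norm_orthonormal_sum:
  assumes E: "orthonormal_basis lam E" and S: "finite S" "S \<subseteq> E"
  shows "(fock_norm lam (\<lambda>z. \<Sum>e\<in>S. c e * e z))\<^sup>2 = (\<Sum>e\<in>S. (norm (c e))\<^sup>2)"
proof -
  let ?p = "\<lambda>z. \<Sum>e\<in>S. c e * e z"
  have SF: "S \<subseteq> fock lam" using orthonormal_basisD(1) [OF E] S by blast
  have p: "?p \<in> fock lam" by (rule fock_sum [OF S(1) SF])
  have "fock_inner lam e ?p = cnj (c e)" if "e \<in> S" for e
  proof -
    have "fock_inner lam ?p e = (\<Sum>e'\<in>S. c e' * fock_inner lam e' e)"
      using that SF by (intro fock_inner_sum_left S) auto
    also have "\<dots> = (\<Sum>e'\<in>S. if e' = e then c e' else 0)"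
      using that S by (intro sum.cong) (auto simp: orthonormal_basisD(2) [OF E] subset_iff)
    also have "\<dots> = c e" using S that by simp
    finally show ?thesis by (subst fock_inner_commute) simp
  qed
  then have "fock_inner lam ?p ?p = (\<Sum>e\<in>S. c e * cnj (c e))"
    by (simp add: fock_inner_sum_left [OF S(1) SF p])
  then have "complex_of_real ((fock_norm lam ?p)\<^sup>2) = complex_of_real (\<Sum>e\<in>S. (norm (c e))\<^sup>2)"
    by (simp only: fock_inner_self mult_cnj_cmod of_real_sum)
  then show ?thesis by (simp only: of_real_eq_iff)
qed

text \<open>Testing the functional on \<open>\<Sum> cnj (\<phi> e) e\<close> is the dual form of Bessel's inequality.\<close>

lemma orthonormal_sum_le:
  assumes E: "orthonormal_basis lam E" and \<phi>: "bounded_functional lam M \<phi>"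
    and S: "finite S" "S \<subseteq> E"
  shows "(\<Sum>e\<in>S. (norm (\<phi> e))\<^sup>2) \<le> M\<^sup>2"
proof -
  define X where "X = (\<Sum>e\<in>S. (norm (\<phi> e))\<^sup>2)"
  define h where "h = (\<lambda>z. \<Sum>e\<in>S. cnj (\<phi> e) * e z)"
  have SF: "S \<subseteq> fock lam" using orthonormal_basisD(1) [OF E] S by blast
  have h: "h \<in> fock lam" unfolding h_def by (rule fock_sum [OF S(1) SF])
  have nh: "(fock_norm lam h)\<^sup>2 = X"
    unfolding h_def X_def by (simp add: fock_norm_orthonormal_sum [OF E S])
  have "\<phi> h = (\<Sum>e\<in>S. cnj (\<phi> e) * \<phi> e)"
    unfolding h_def by (rule bounded_functional_sum [OF \<phi> S(1) SF])
  also have "\<dots> = complex_of_real X"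
    unfolding X_def of_real_sum by (rule sum.cong) (simp_all add: mult_cnj_cmod mult.commute del: of_real_power)
  finally have "\<phi> h = complex_of_real X" .
  moreover have "X \<ge> 0" unfolding X_def by (simp add: sum_nonneg)
  moreover have "norm (\<phi> h) \<le> M * fock_norm lam h"
    using \<phi> h unfolding bounded_functional_def by blast
  ultimately have "(fock_norm lam h)\<^sup>2 \<le> M * fock_norm lam h" using nh by simp
  \<comment> \<open>Dividing by the norm of h, with the zero case kept apart.\<close>
  then have "fock_norm lam h \<le> M \<or> fock_norm lam h = 0"
    using fock_norm_ge_0 [of lam h] by (auto simp: power2_eq_square mult_le_cancel_right)
  then have "(fock_norm lam h)\<^sup>2 \<le> M\<^sup>2"
    using fock_norm_ge_0 [of lam h] by (auto intro: power_mono)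
  then show ?thesis by (simp add: nh X_def)
qed

text \<open>Conversely, the values on an orthonormal basis control the norm of a functional. This uses
  only that the span of the basis is dense, not that the space is complete.\<close>

lemma bounded_functional_le:
  assumes E: "orthonormal_basis lam E" and \<phi>: "bounded_functional lam M \<phi>"
    and B: "\<And>S. finite S \<Longrightarrow> S \<subseteq> E \<Longrightarrow> (\<Sum>e\<in>S. (norm (\<phi> e))\<^sup>2) \<le> B"
  shows "bounded_functional lam (sqrt B) \<phi>"
proof -
  have B0: "B \<ge> 0" using B [of "{}"] by simp
  have "norm (\<phi> f) \<le> sqrt B * fock_norm lam f" if f: "f \<in> fock lam" for f
  proof (rule field_le_epsilon)
    fix \<delta> :: real assume \<delta>: "\<delta> > 0"
    \<comment> \<open>Chosen so that the total error
      \<open>(sqrt B + \<bar>M\<bar>) * \<epsilon>\<close> stays below \<open>\<delta>\<close>; the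
      summand 1 keeps the denominator positive.\<close>
    define \<epsilon> where "\<epsilon> = \<delta> / (sqrt B + \<bar>M\<bar> + 1)"
    have den: "sqrt B + \<bar>M\<bar> + 1 > 0" using B0 by (simp add: add_nonneg_pos)
    then have \<epsilon>: "\<epsilon> > 0" using \<delta> by (simp add: \<epsilon>_def)
    obtain S c where S: "finite S" "S \<subseteq> E"
        and fp: "fock_norm lam (\<lambda>z. f z - (\<Sum>e\<in>S. c e * e z)) < \<epsilon>"
      using orthonormal_basisD(3) [OF E f \<epsilon>] by blast
    define p where "p = (\<lambda>z. \<Sum>e\<in>S. c e * e z)"
    define d where "d = (\<lambda>z. f z - p z)"
    have SF: "S \<subseteq> fock lam" using orthonormal_basisD(1) [OF E] S by blast
    have p: "p \<in> fock lam" unfolding p_def by (rule fock_sum [OF S(1) SF])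
    have d: "d \<in> fock lam" unfolding d_def by (rule fock_diff [OF f p])
    have nd: "fock_norm lam d < \<epsilon>" using fp by (simp add: d_def p_def)
    have "\<phi> (\<lambda>z. p z + d z) = \<phi> p + \<phi> d"
      using \<phi> p d unfolding bounded_functional_def by blast
    then have "norm (\<phi> f) \<le> norm (\<phi> p) + norm (\<phi> d)"
      by (simp add: d_def norm_triangle_ineq)
    moreover have "norm (\<phi> d) \<le> \<bar>M\<bar> * \<epsilon>"
    proof -
      have "norm (\<phi> d) \<le> M * fock_norm lam d"
        using \<phi> d unfolding bounded_functional_def by blast
      also have "\<dots> \<le> \<bar>M\<bar> * \<epsilon>"
        using nd fock_norm_ge_0 by (intro mult_mono) auto
      finally show ?thesis .
    qed
    \<comment> \<open>The sharp constant comes from the finite Cauchy-Schwarz inequality on the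
      combination p; the crude bound M acts only on the small remainder d. The norm of p is
      controlled because p = f - d.\<close>
    moreover have "norm (\<phi> p) \<le> sqrt B * (fock_norm lam f + \<epsilon>)"
    proof -
      have "norm (\<phi> p) \<le> (\<Sum>e\<in>S. \<bar>norm (c e)\<bar> * \<bar>norm (\<phi> e)\<bar>)"
        unfolding p_def bounded_functional_sum [OF \<phi> S(1) SF]
        by (rule order_trans [OF norm_sum]) (simp add: norm_mult)
      also have "\<dots> \<le> L2_set (\<lambda>e. norm (c e)) S * L2_set (\<lambda>e. norm (\<phi> e)) S"
        by (rule L2_set_mult_ineq)
      also have "L2_set (\<lambda>e. norm (c e)) S = fock_norm lam p"
        by (simp add: L2_set_def p_def fock_norm_ge_0 flip: fock_norm_orthonormal_sum [OF E S])
      also have "fock_norm lam p * L2_set (\<lambda>e. norm (\<phi> e)) S \<le> fock_norm lam p * sqrt B"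
        using B [OF S] by (intro mult_left_mono) (simp_all add: L2_set_def fock_norm_ge_0)
      also have "\<dots> \<le> (fock_norm lam f + \<epsilon>) * sqrt B"
      proof (rule mult_right_mono)
        show "fock_norm lam p \<le> fock_norm lam f + \<epsilon>"
          using fock_norm_triangle_diff [OF f d] nd by (simp add: d_def)
      qed (simp add: B0)
      finally show ?thesis by (simp add: mult.commute)
    qed
    ultimately have "norm (\<phi> f) \<le> sqrt B * fock_norm lam f + (sqrt B + \<bar>M\<bar>) * \<epsilon>"
      by (simp add: algebra_simps)
    also have "(sqrt B + \<bar>M\<bar>) * \<epsilon> \<le> (sqrt B + \<bar>M\<bar> + 1) * \<epsilon>"
      using \<epsilon> by (intro mult_right_mono) auto
    also have "\<dots> = \<delta>" using den by (simp add: \<epsilon>_def)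
    finally show "norm (\<phi> f) \<le> sqrt B * fock_norm lam f + \<delta>" by simp
  qed
  then show ?thesis using \<phi> by (simp add: bounded_functional_def)
qed

lemma functional_summable:
  assumes E: "orthonormal_basis lam E" and \<phi>: "bounded_functional lam M \<phi>"
  shows "(\<lambda>e. (norm (\<phi> e))\<^sup>2) summable_on E"
  by (rule nonneg_bdd_above_summable_on)
    (auto intro!: bdd_aboveI [of _ "M\<^sup>2"] orthonormal_sum_le [OF E \<phi>])

text \<open>One inequality is Bessel's. For the other, \<open>bounded_functional_le\<close> bounds
  the functional <., f> by \<open>sqrt s\<close>; evaluating it at f itself gives |f|^2 <= sqrt s
  |f|.\<close>

lemma Parseval:
  assumes E: "orthonormal_basis lam E" and f: "f \<in> fock lam"
  shows "((\<lambda>e. (norm (fock_inner lam e f))\<^sup>2) has_sum (fock_norm lam f)\<^sup>2) E"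
proof -
  let ?\<phi> = "\<lambda>e. fock_inner lam e f"
  note \<phi> = bounded_functional_inner [OF f]
  define s where "s = infsum (\<lambda>e. (norm (?\<phi> e))\<^sup>2) E"
  have hs: "((\<lambda>e. (norm (?\<phi> e))\<^sup>2) has_sum s) E"
    unfolding s_def by (rule has_sum_infsum [OF functional_summable [OF E \<phi>]])
  have "s \<le> (fock_norm lam f)\<^sup>2"
    using hs by (rule has_sum_le_finite_sums) (rule orthonormal_sum_le [OF E \<phi>])
  moreover have "(fock_norm lam f)\<^sup>2 \<le> s"
  proof -
    have part: "(\<Sum>e\<in>S. (norm (?\<phi> e))\<^sup>2) \<le> s" if "finite S" "S \<subseteq> E" for S
      using that by (intro has_sum_mono2 [OF has_sum_finite hs]) auto
    then have "s \<ge> 0" using part [of "{}"] by simp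
    have "norm (fock_inner lam f f) \<le> sqrt s * fock_norm lam f"
      using bounded_functional_le [OF E \<phi> part] f unfolding bounded_functional_def by blast
    then have "(fock_norm lam f)\<^sup>2 \<le> sqrt s * fock_norm lam f"
      by (simp add: fock_inner_self norm_power)
    then have "fock_norm lam f \<le> sqrt s \<or> fock_norm lam f = 0"
      using fock_norm_ge_0 [of lam f] by (auto simp: power2_eq_square mult_le_cancel_right)
    then show ?thesis
      using \<open>s \<ge> 0\<close> fock_norm_ge_0 [of lam f] by (auto dest: real_le_rsqrt simp: sqrt_le_D real_sqrt_ge_0_iff
          intro: order_trans [OF power_mono [of "fock_norm lam f" "sqrt s" 2]])
  qed
  ultimately show ?thesis using hs by simp
qed

definition fock_bounded ::
  "real \<Rightarrow> ((complex^'n \<Rightarrow> complex) \<Rightarrow> complex^'n \<Rightarrow> complex) \<Rightarrow> bool" where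
  "fock_bounded lam A \<longleftrightarrow> fock_operator lam (fock lam) A \<and>
     (\<exists>K. \<forall>f\<in>fock lam. fock_norm lam (A f) \<le> K * fock_norm lam f)"

lemma hilbert_schmidt_iff:
  "hilbert_schmidt lam A \<longleftrightarrow> fock_bounded lam A \<and>
     (\<exists>E. orthonormal_basis lam E \<and> (\<lambda>e. (fock_norm lam (A e))\<^sup>2) summable_on E)"
  by (simp add: hilbert_schmidt_def fock_bounded_def)

text \<open>This functional stands in for the vector that the adjoint of A assigns to k.\<close>

lemma bounded_functional_matrix_coefficient:
  assumes A: "fock_bounded lam A" and k: "k \<in> fock lam"
  shows "\<exists>M. bounded_functional lam M (\<lambda>f. fock_inner lam (A f) k)"
proof -
  obtain K where K: "\<And>f. f \<in> fock lam \<Longrightarrow> fock_norm lam (A f) \<le> K * fock_norm lam f"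
    and op: "fock_operator lam (fock lam) A"
    using A unfolding fock_bounded_def by blast
  have Af: "A f \<in> fock lam" if "f \<in> fock lam" for f
    using op that unfolding fock_operator_def by blast
  have "norm (fock_inner lam (A f) k) \<le> K * fock_norm lam k * fock_norm lam f"
    if f: "f \<in> fock lam" for f
  proof -
    have "norm (fock_inner lam (A f) k) \<le> fock_norm lam (A f) * fock_norm lam k"
      by (rule fock_Cauchy_Schwarz [OF Af [OF f] k])
    also have "\<dots> \<le> K * fock_norm lam f * fock_norm lam k"
      by (rule mult_right_mono [OF K [OF f] fock_norm_ge_0])
    finally show ?thesis by (simp add: mult_ac)
  qed
  moreover have "fock_inner lam (A (\<lambda>z. f z + h z)) k = fock_inner lam (A f) k + fock_inner lam (A h) k"
    if "f \<in> fock lam" "h \<in> fock lam" for f h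
  proof -
    have "A (\<lambda>z. f z + h z) = (\<lambda>z. A f z + A h z)"
      using op that unfolding fock_operator_def by blast
    then show ?thesis by (simp add: fock_inner_add_left Af that k)
  qed
  moreover have "fock_inner lam (A (\<lambda>z. c * f z)) k = c * fock_inner lam (A f) k"
    if "f \<in> fock lam" for c f
  proof -
    have "A (\<lambda>z. c * f z) = (\<lambda>z. c * A f z)"
      using op that unfolding fock_operator_def by blast
    then show ?thesis by (simp add: fock_inner_scale_left)
  qed
  ultimately show ?thesis unfolding bounded_functional_def by blast
qed

lemma has_sum_sum:
  fixes f :: "'i \<Rightarrow> 'a \<Rightarrow> 'b::topological_comm_monoid_add"
  assumes "finite I" "\<And>i. i \<in> I \<Longrightarrow> (f i has_sum s i) A"
  shows "((\<lambda>x. \<Sum>i\<in>I. f i x) has_sum (\<Sum>i\<in>I. s i)) A"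
  using assms by (induction I) (simp_all add: has_sum_add)

text \<open>Expand each |A e|^2 by Parseval in k over E. For fixed k, the sum of |<A e, k>|^2 over S
  is at most the squared norm of f -> <A f, k>, hence at most \<open>b k\<close>, its sum over E.
  This trades E' for E, and summing \<open>b k\<close> over k leads back to the given sum over
  E.\<close>

lemma hs_sum_le:
  assumes A: "fock_bounded lam A" and E: "orthonormal_basis lam E" and E': "orthonormal_basis lam E'"
    and s: "((\<lambda>e. (fock_norm lam (A e))\<^sup>2) has_sum s) E"
    and S: "finite S" "S \<subseteq> E'"
  shows "(\<Sum>e\<in>S. (fock_norm lam (A e))\<^sup>2) \<le> s"
proof -
  have Af: "A f \<in> fock lam" if "f \<in> fock lam" for f
    using A that unfolding fock_bounded_def fock_operator_def by blast
  have EF: "E \<subseteq> fock lam" "E' \<subseteq> fock lam"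
    using E E' by (auto simp: orthonormal_basis_def)
  let ?m = "\<lambda>k e. (norm (fock_inner lam (A e) k))\<^sup>2"
  have m: "?m k e = (norm (fock_inner lam k (A e)))\<^sup>2" for k e
    by (subst fock_inner_commute) simp
  have "((\<lambda>k. \<Sum>e\<in>S. ?m k e) has_sum (\<Sum>e\<in>S. (fock_norm lam (A e))\<^sup>2)) E"
    unfolding m using S EF by (intro has_sum_sum Parseval [OF E] Af) auto
  then show ?thesis
  proof (rule has_sum_le_finite_sums)
    fix G assume G: "finite G" "G \<subseteq> E"
    define b where "b k = infsum (?m k) E" for k
    have b: "(?m k has_sum b k) E" and bS: "(\<Sum>e\<in>S. ?m k e) \<le> b k" if "k \<in> G" for k
    proof -
      have "k \<in> fock lam" using that G EF by blast
      then obtain M where M: "bounded_functional lam M (\<lambda>f. fock_inner lam (A f) k)"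
        using bounded_functional_matrix_coefficient [OF A] by blast
      show hs: "(?m k has_sum b k) E"
        unfolding b_def by (rule has_sum_infsum [OF functional_summable [OF E M]])
      have part: "(\<Sum>e\<in>S. ?m k e) \<le> b k" if "finite S" "S \<subseteq> E" for S
        using that by (intro has_sum_mono2 [OF has_sum_finite hs]) auto
      have "b k \<ge> 0" using part [of "{}"] by simp
      then show "(\<Sum>e\<in>S. ?m k e) \<le> b k"
        using orthonormal_sum_le [OF E' bounded_functional_le [OF E M part] S] by simp
    qed
    have "(\<Sum>k\<in>G. \<Sum>e\<in>S. ?m k e) \<le> (\<Sum>k\<in>G. b k)"
      by (rule sum_mono) (rule bS)
    \<comment> \<open>A finite sum over k may be exchanged with the sum over E; for each e in E,
      Bessel's inequality then bounds the sum over k by |A e|^2.\<close>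
    also have "\<dots> \<le> s"
    proof (rule has_sum_mono [OF _ s])
      show "((\<lambda>e. \<Sum>k\<in>G. ?m k e) has_sum (\<Sum>k\<in>G. b k)) E"
        using G b by (intro has_sum_sum) auto
      show "(\<Sum>k\<in>G. ?m k e) \<le> (fock_norm lam (A e))\<^sup>2" if "e \<in> E" for e
        unfolding m using that EF
        by (intro orthonormal_sum_le [OF E bounded_functional_inner G] Af) auto
    qed
    finally show "(\<Sum>k\<in>G. \<Sum>e\<in>S. ?m k e) \<le> s" .
  qed
qed

text \<open>The finite bounds of \<open>hs_sum_le\<close> give summability over E'. The two bases
  can then exchange their roles, which gives both inequalities between the sums.\<close>

lemma hs_sum_basis_independent:
  assumes A: "fock_bounded lam A" and E: "orthonormal_basis lam E" and E': "orthonormal_basis lam E'"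
    and s: "((\<lambda>e. (fock_norm lam (A e))\<^sup>2) has_sum s) E"
  shows "((\<lambda>e. (fock_norm lam (A e))\<^sup>2) has_sum s) E'"
proof -
  let ?f = "\<lambda>e. (fock_norm lam (A e))\<^sup>2"
  have "?f summable_on E'"
    by (rule nonneg_bdd_above_summable_on)
      (auto intro!: bdd_aboveI [of _ s] hs_sum_le [OF A E E' s])
  then have s': "(?f has_sum infsum ?f E') E'" by (rule has_sum_infsum)
  have "infsum ?f E' \<le> s"
    using s' by (rule has_sum_le_finite_sums) (rule hs_sum_le [OF A E E' s])
  moreover have "s \<le> infsum ?f E'"
    using s by (rule has_sum_le_finite_sums) (rule hs_sum_le [OF A E' E s'])
  ultimately show ?thesis using s' by simp
qed

lemma hs_norm_eq:
  assumes A: "fock_bounded lam A" and E: "orthonormal_basis lam E"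
    and s: "((\<lambda>e. (fock_norm lam (A e))\<^sup>2) has_sum s) E"
  shows "hs_norm lam A = sqrt s"
proof -
  have "(THE s. \<forall>E. orthonormal_basis lam E \<longrightarrow> ((\<lambda>e. (fock_norm lam (A e))\<^sup>2) has_sum s) E) = s"
  proof (rule the_equality)
    show "\<forall>E. orthonormal_basis lam E \<longrightarrow> ((\<lambda>e. (fock_norm lam (A e))\<^sup>2) has_sum s) E"
      using hs_sum_basis_independent [OF A E _ s] by blast
    show "t = s" if "\<forall>E. orthonormal_basis lam E \<longrightarrow> ((\<lambda>e. (fock_norm lam (A e))\<^sup>2) has_sum t) E" for t
      using that E s has_sum_unique by blast
  qed
  then show ?thesis by (simp add: hs_norm_def)
qed

lemma fock_operatorD:
  assumes "fock_operator lam D A"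
  shows "D \<subseteq> fock lam" and "(\<lambda>_. 0) \<in> D"
    and "\<And>f h. f \<in> D \<Longrightarrow> h \<in> D \<Longrightarrow> (\<lambda>z. f z + h z) \<in> D"
    and "\<And>c f. f \<in> D \<Longrightarrow> (\<lambda>z. c * f z) \<in> D"
    and "\<And>f. f \<in> D \<Longrightarrow> A f \<in> fock lam"
    and "\<And>f h. f \<in> D \<Longrightarrow> h \<in> D \<Longrightarrow> A (\<lambda>z. f z + h z) = (\<lambda>z. A f z + A h z)"
    and "\<And>c f. f \<in> D \<Longrightarrow> A (\<lambda>z. c * f z) = (\<lambda>z. c * A f z)"
proof -
  note * = assms [unfolded fock_operator_def]
  note 2 = * [THEN conjunct2, THEN conjunct2]
  note 4 = 2 [THEN conjunct2, THEN conjunct2]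
  show "D \<subseteq> fock lam" by (rule * [THEN conjunct1])
  show "(\<lambda>_. 0) \<in> D" by (rule * [THEN conjunct2, THEN conjunct1])
  show "(\<lambda>z. f z + h z) \<in> D" if "f \<in> D" "h \<in> D" for f h
    by (rule 2 [THEN conjunct1, THEN bspec, OF that(1), THEN bspec, OF that(2)])
  show "(\<lambda>z. c * f z) \<in> D" if "f \<in> D" for c f
    by (rule 2 [THEN conjunct2, THEN conjunct1, THEN spec, THEN bspec, OF that])
  show "A f \<in> fock lam" if "f \<in> D" for f
    by (rule 4 [THEN conjunct1, THEN bspec, OF that])
  show "A (\<lambda>z. f z + h z) = (\<lambda>z. A f z + A h z)" if "f \<in> D" "h \<in> D" for f h
    by (rule 4 [THEN conjunct2, THEN conjunct1, THEN bspec, OF that(1), THEN bspec, OF that(2)])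
  show "A (\<lambda>z. c * f z) = (\<lambda>z. c * A f z)" if "f \<in> D" for c f
    by (rule 4 [THEN conjunct2, THEN conjunct2, THEN spec, THEN bspec, OF that])
qed

lemma fock_operatorI:
  assumes "\<And>f. f \<in> fock lam \<Longrightarrow> A f \<in> fock lam"
    and "\<And>f h. f \<in> fock lam \<Longrightarrow> h \<in> fock lam \<Longrightarrow> A (\<lambda>z. f z + h z) = (\<lambda>z. A f z + A h z)"
    and "\<And>c f. f \<in> fock lam \<Longrightarrow> A (\<lambda>z. c * f z) = (\<lambda>z. c * A f z)"
  shows "fock_operator lam (fock lam) A"
  unfolding fock_operator_def
  by (intro conjI ballI allI order_refl fock_zero fock_add fock_scale assms)

lemma fock_boundedD:
  assumes "fock_bounded lam A"
  shows "fock_operator lam (fock lam) A"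
    and "\<exists>K\<ge>0. \<forall>f\<in>fock lam. fock_norm lam (A f) \<le> K * fock_norm lam f"
proof -
  show "fock_operator lam (fock lam) A" using assms by (simp add: fock_bounded_def)
  obtain K where K: "\<forall>f\<in>fock lam. fock_norm lam (A f) \<le> K * fock_norm lam f"
    using assms unfolding fock_bounded_def by blast
  have "fock_norm lam (A f) \<le> \<bar>K\<bar> * fock_norm lam f" if "f \<in> fock lam" for f
    using bspec [OF K that] mult_right_mono [OF abs_ge_self fock_norm_ge_0, of K lam f] by linarith
  then show "\<exists>K\<ge>0. \<forall>f\<in>fock lam. fock_norm lam (A f) \<le> K * fock_norm lam f"
    by (intro exI [of _ "\<bar>K\<bar>"]) simp
qed

section \<open>Products and differences of bounded operators\<close>

lemma fock_bounded_compose: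
  assumes "fock_bounded lam A" "fock_bounded lam B"
  shows "fock_bounded lam (\<lambda>f. A (B f))"
proof -
  note A = fock_operatorD [OF fock_boundedD(1) [OF assms(1)]]
  note B = fock_operatorD [OF fock_boundedD(1) [OF assms(2)]]
  obtain K L where K: "K \<ge> 0" "\<forall>f\<in>fock lam. fock_norm lam (A f) \<le> K * fock_norm lam f"
    and L: "\<forall>f\<in>fock lam. fock_norm lam (B f) \<le> L * fock_norm lam f"
    using fock_boundedD(2) [OF assms(1)] fock_boundedD(2) [OF assms(2)] by blast
  have "fock_norm lam (A (B f)) \<le> K * L * fock_norm lam f" if f: "f \<in> fock lam" for f
  proof -
    have "fock_norm lam (A (B f)) \<le> K * fock_norm lam (B f)"
      by (rule bspec [OF K(2) B(5) [OF f]])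
    also have "\<dots> \<le> K * (L * fock_norm lam f)"
      by (rule mult_left_mono [OF bspec [OF L f] K(1)])
    finally show ?thesis by simp
  qed
  moreover have "fock_operator lam (fock lam) (\<lambda>f. A (B f))"
  proof (rule fock_operatorI)
    show "A (B f) \<in> fock lam" if "f \<in> fock lam" for f
      by (rule A(5) [OF B(5) [OF that]])
    show "A (B (\<lambda>z. f z + h z)) = (\<lambda>z. A (B f) z + A (B h) z)"
      if "f \<in> fock lam" "h \<in> fock lam" for f h
      by (subst B(6) [OF that], rule A(6)) (rule B(5) that)+
    show "A (B (\<lambda>z. c * f z)) = (\<lambda>z. c * A (B f) z)" if "f \<in> fock lam" for c f
      by (subst B(7) [OF that], rule A(7) [OF B(5) [OF that]])
  qed
  ultimately show ?thesis
    unfolding fock_bounded_def by (intro conjI exI [of _ "K * L"] ballI)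
qed

lemma fock_bounded_diff:
  assumes "fock_bounded lam A" "fock_bounded lam B"
  shows "fock_bounded lam (\<lambda>f z. A f z - B f z)"
proof -
  note A = fock_operatorD [OF fock_boundedD(1) [OF assms(1)]]
  note B = fock_operatorD [OF fock_boundedD(1) [OF assms(2)]]
  obtain K L where K: "\<forall>f\<in>fock lam. fock_norm lam (A f) \<le> K * fock_norm lam f"
    and L: "\<forall>f\<in>fock lam. fock_norm lam (B f) \<le> L * fock_norm lam f"
    using fock_boundedD(2) [OF assms(1)] fock_boundedD(2) [OF assms(2)] by blast
  have "fock_norm lam (\<lambda>z. A f z - B f z) \<le> (K + L) * fock_norm lam f"
    if f: "f \<in> fock lam" for f
    using fock_norm_triangle_diff [OF A(5) [OF f] B(5) [OF f]] bspec [OF K f] bspec [OF L f]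
    by (simp add: distrib_right)
  moreover have "fock_operator lam (fock lam) (\<lambda>f z. A f z - B f z)"
  proof (rule fock_operatorI)
    show "(\<lambda>z. A f z - B f z) \<in> fock lam" if "f \<in> fock lam" for f
      by (rule fock_diff [OF A(5) [OF that] B(5) [OF that]])
    show "(\<lambda>z. A (\<lambda>z. f z + h z) z - B (\<lambda>z. f z + h z) z) =
        (\<lambda>z. A f z - B f z + (A h z - B h z))" if "f \<in> fock lam" "h \<in> fock lam" for f h
      unfolding A(6) [OF that] B(6) [OF that] by (rule ext) simp
    show "(\<lambda>z. A (\<lambda>z. c * f z) z - B (\<lambda>z. c * f z) z) = (\<lambda>z. c * (A f z - B f z))"
      if "f \<in> fock lam" for c f
      unfolding A(7) [OF that] B(7) [OF that] right_diff_distrib ..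
  qed
  ultimately show ?thesis
    unfolding fock_bounded_def by (intro conjI exI [of _ "K + L"] ballI)
qed

section \<open>Approximation by operators of finite rank\<close>

lemma norm_fock_inner_commute: "norm (fock_inner lam f h) = norm (fock_inner lam h f)"
  by (subst fock_inner_commute) simp

text \<open>For a finite orthonormal set S this is the orthogonal projection onto its span.\<close>

definition fock_proj ::
  "real \<Rightarrow> (complex^'n \<Rightarrow> complex) set \<Rightarrow> (complex^'n \<Rightarrow> complex) \<Rightarrow> complex^'n \<Rightarrow> complex" where
  "fock_proj lam S f = (\<lambda>z. \<Sum>e\<in>S. fock_inner lam f e * e z)"

lemma fock_proj_basis:
  assumes E: "orthonormal_basis lam E" and S: "finite S" "S \<subseteq> E" and e: "e \<in> E"
  shows "fock_proj lam S e = (if e \<in> S then e else (\<lambda>_. 0))"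
proof
  fix z
  have "fock_inner lam e e' * e' z = (if e = e' then e z else 0)" if "e' \<in> S" for e'
    using orthonormal_basisD(2) [OF E e, of e'] that S(2) by (cases "e = e'") auto
  then have "fock_proj lam S e z = (\<Sum>e'\<in>S. if e = e' then e z else 0)"
    unfolding fock_proj_def by (rule sum.cong [OF refl])
  also have "\<dots> = (if e \<in> S then e z else 0)"
    by (rule sum.delta' [OF S(1)])
  finally show "fock_proj lam S e z = (if e \<in> S then e else (\<lambda>_. 0)) z"
    by (cases "e \<in> S") simp_all
qed

lemma hilbert_schmidt_fock_proj:
  assumes E: "orthonormal_basis lam E" and S: "finite S" "S \<subseteq> E"
  shows "hilbert_schmidt lam (fock_proj lam S)"
proof -
  have SF: "S \<subseteq> fock lam" using orthonormal_basisD(1) [OF E] S by blast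
  have "fock_operator lam (fock lam) (fock_proj lam S)"
  proof (rule fock_operatorI)
    show "fock_proj lam S f \<in> fock lam" if "f \<in> fock lam" for f
      unfolding fock_proj_def by (rule fock_sum [OF S(1) SF])
    show "fock_proj lam S (\<lambda>z. f z + h z) = (\<lambda>z. fock_proj lam S f z + fock_proj lam S h z)"
      if "f \<in> fock lam" "h \<in> fock lam" for f h
    proof -
      have "fock_inner lam (\<lambda>z. f z + h z) e = fock_inner lam f e + fock_inner lam h e"
        if "e \<in> S" for e
        using that SF by (intro fock_inner_add_left \<open>f \<in> fock lam\<close> \<open>h \<in> fock lam\<close>) auto
      then show ?thesis
        unfolding fock_proj_def sum.distrib [symmetric] distrib_right [symmetric]
        by (intro ext sum.cong refl arg_cong2 [of _ _ _ _ "(*)"])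
    qed
    show "fock_proj lam S (\<lambda>z. c * f z) = (\<lambda>z. c * fock_proj lam S f z)" for c f
      by (simp add: fock_proj_def fock_inner_scale_left sum_distrib_left mult.assoc)
  qed
  moreover have "fock_norm lam (fock_proj lam S f) \<le> 1 * fock_norm lam f" if f: "f \<in> fock lam" for f
  proof -
    have "(fock_norm lam (fock_proj lam S f))\<^sup>2 = (\<Sum>e\<in>S. (norm (fock_inner lam f e))\<^sup>2)"
      unfolding fock_proj_def by (rule fock_norm_orthonormal_sum [OF E S])
    also have "\<dots> = (\<Sum>e\<in>S. (norm (fock_inner lam e f))\<^sup>2)"
      by (simp only: norm_fock_inner_commute [of lam f])
    also have "\<dots> \<le> (fock_norm lam f)\<^sup>2"
      by (rule orthonormal_sum_le [OF E bounded_functional_inner [OF f] S])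
    finally show ?thesis
      unfolding mult_1 by (rule power2_le_imp_le) (rule fock_norm_ge_0)
  qed
  moreover have "(\<lambda>e. (fock_norm lam (fock_proj lam S e))\<^sup>2) summable_on E"
  proof -
    have "(\<lambda>e. (fock_norm lam (fock_proj lam S e))\<^sup>2) summable_on S"
      using S by simp
    then show ?thesis
      by (rule summable_on_cong_neutral [THEN iffD1, rotated -1])
        (use S in \<open>auto simp: fock_proj_basis [OF E S]\<close>)
  qed
  ultimately show ?thesis
    unfolding hilbert_schmidt_def using E
    by (intro conjI exI [of _ "1 :: real"] exI [of _ E] ballI)
qed

text \<open>A composed with the projection onto finitely many basis vectors is trace class by
  definition, as both factors are Hilbert-Schmidt. Its difference from A vanishes on the chosen
  basis vectors and is -A on the others, so the squared Hilbert-Schmidt distance is a tail of a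
  convergent sum.\<close>

lemma trace_class_dense:
  assumes A: "hilbert_schmidt lam A"
  obtains T where "\<And>k::nat. trace_class lam (T k)"
    and "(\<lambda>k. hs_norm lam (\<lambda>f z. T k f z - A f z)) \<longlonglongrightarrow> 0"
proof -
  have Ab: "fock_bounded lam A" using A by (simp add: hilbert_schmidt_iff)
  note Aop = fock_operatorD [OF fock_boundedD(1) [OF Ab]]
  obtain E where E: "orthonormal_basis lam E"
      and sm: "(\<lambda>e. (fock_norm lam (A e))\<^sup>2) summable_on E"
    using A [unfolded hilbert_schmidt_iff, THEN conjunct2] by (elim exE conjE) (rule that)
  let ?a = "\<lambda>e. (fock_norm lam (A e))\<^sup>2"
  \<comment> \<open>The basis carries no enumeration; a sequence of finite subsets is obtained by
    prescribing the accuracy 1 / (k + 1).\<close>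
  have "\<forall>k. \<exists>S. finite S \<and> S \<subseteq> E \<and> dist (sum ?a S) (infsum ?a E) \<le> 1 / real (Suc k)"
    by (intro allI infsum_finite_approximation [OF sm]) simp
  from choice [OF this] obtain S where S: "\<And>k. finite (S k)" "\<And>k. S k \<subseteq> E"
      and Sd: "\<And>k. dist (sum ?a (S k)) (infsum ?a E) \<le> 1 / real (Suc k)"
    by blast
  define T where "T k f = A (fock_proj lam (S k) f)" for k f
  have P: "hilbert_schmidt lam (fock_proj lam (S k))" for k
    by (rule hilbert_schmidt_fock_proj [OF E S])
  have "trace_class lam (T k)" for k
    unfolding trace_class_def T_def
    by (intro exI [of _ A] exI [of _ "fock_proj lam (S k)"] conjI A P ballI refl)
  moreover have "(\<lambda>k. hs_norm lam (\<lambda>f z. T k f z - A f z)) \<longlonglongrightarrow> 0"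
  proof -
    let ?s = "\<lambda>k. infsum ?a E - sum ?a (S k)"
    have "hs_norm lam (\<lambda>f z. T k f z - A f z) = sqrt (?s k)" for k
    proof (rule hs_norm_eq [OF _ E])
      show "fock_bounded lam (\<lambda>f z. T k f z - A f z)"
        unfolding T_def
        by (rule fock_bounded_diff [OF fock_bounded_compose Ab])
          (rule Ab P [unfolded hilbert_schmidt_iff, THEN conjunct1])+
      have "A (\<lambda>_. 0) = (\<lambda>_. 0)"
        using Aop(7) [OF fock_zero, of 0] by simp
      then have T: "fock_norm lam (\<lambda>z. T k e z - A e z) = (if e \<in> S k then 0 else fock_norm lam (A e))"
        if "e \<in> E" for e
        using that by (simp add: T_def fock_proj_basis [OF E S] fock_norm_minus)
      have "(?a has_sum ?s k) (E - S k)"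
        using S by (intro has_sum_Diff has_sum_infsum sm has_sum_finite)
      then show "((\<lambda>e. (fock_norm lam (\<lambda>z. T k e z - A e z))\<^sup>2) has_sum ?s k) E"
        by (rule has_sum_cong_neutral [THEN iffD1, rotated -1]) (auto simp: T)
    qed
    moreover have "?s \<longlonglongrightarrow> 0"
    proof (rule Lim_null_comparison [OF _ LIMSEQ_inverse_real_of_nat])
      show "\<forall>\<^sub>F k in sequentially. norm (?s k) \<le> inverse (real (Suc k))"
        using Sd by (intro always_eventually allI) (simp add: dist_real_def abs_minus_commute inverse_eq_divide)
    qed
    then have "(\<lambda>k. sqrt (?s k)) \<longlonglongrightarrow> sqrt 0"
      by (rule tendsto_real_sqrt)
    ultimately show ?thesis by simp
  qed
  ultimately show ?thesis by (rule that)
qed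

section \<open>Uniqueness of the square-integrable symbol\<close>

lemma L2_mu_norm_zero_AE:
  assumes "F \<in> L2_mu lam" "L2_mu_norm lam F = 0"
  shows "AE z in mu lam. F z = 0"
  using assms integral_nonneg_eq_0_iff_AE [of "mu lam" "\<lambda>z. (norm (F z))\<^sup>2"]
  by (simp add: L2_mu_def L2_mu_norm_def)

text \<open>The inequality (a + b)^2 <= 2 a^2 + 2 b^2, integrated, serves in place of Minkowski's;
  the factor 2 is harmless for terms tending to 0.\<close>

lemma L2_mu_diff:
  assumes F: "F \<in> L2_mu lam" and H: "H \<in> L2_mu lam"
  shows "(\<lambda>z. F z - H z) \<in> L2_mu lam"
    and "(L2_mu_norm lam (\<lambda>z. F z - H z))\<^sup>2 \<le> 2 * (L2_mu_norm lam F)\<^sup>2 + 2 * (L2_mu_norm lam H)\<^sup>2"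
proof -
  have m [measurable]: "F \<in> borel_measurable borel" "H \<in> borel_measurable borel"
    and i: "integrable (mu lam) (\<lambda>z. (norm (F z))\<^sup>2)" "integrable (mu lam) (\<lambda>z. (norm (H z))\<^sup>2)"
    using F H by (auto simp: L2_mu_def)
  have i2: "integrable (mu lam) (\<lambda>z. 2 * (norm (F z))\<^sup>2 + 2 * (norm (H z))\<^sup>2)"
    by (intro Bochner_Integration.integrable_add integrable_mult_right i)
  have le: "(norm (F z - H z))\<^sup>2 \<le> 2 * (norm (F z))\<^sup>2 + 2 * (norm (H z))\<^sup>2" for z
  proof -
    have "(norm (F z - H z))\<^sup>2 \<le> (norm (F z) + norm (H z))\<^sup>2"
      by (intro power_mono norm_triangle_ineq4 norm_ge_zero)
    also have "\<dots> \<le> 2 * (norm (F z))\<^sup>2 + 2 * (norm (H z))\<^sup>2"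
      using sum_squares_bound [of "norm (F z)" "norm (H z)"] by (simp add: power2_sum)
    finally show ?thesis .
  qed
  have id: "integrable (mu lam) (\<lambda>z. (norm (F z - H z))\<^sup>2)"
    by (rule Bochner_Integration.integrable_bound [OF i2]) (auto simp: le)
  then show "(\<lambda>z. F z - H z) \<in> L2_mu lam"
    by (simp add: L2_mu_def)
  have "(LINT z|mu lam. (norm (F z - H z))\<^sup>2) \<le> (LINT z|mu lam. 2 * (norm (F z))\<^sup>2 + 2 * (norm (H z))\<^sup>2)"
    by (rule integral_mono [OF id i2]) (rule le)
  then show "(L2_mu_norm lam (\<lambda>z. F z - H z))\<^sup>2 \<le> 2 * (L2_mu_norm lam F)\<^sup>2 + 2 * (L2_mu_norm lam H)\<^sup>2"
    using i by (simp add: L2_mu_norm_def)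
qed

text \<open>Without \<open>trace_class_dense\<close> the defining condition could hold vacuously.\<close>

lemma is_weyl_L2_unique:
  assumes A: "hilbert_schmidt lam A" and F: "is_weyl_L2 lam A F" and H: "is_weyl_L2 lam A H"
  shows "AE z in mu lam. F z = H z"
proof -
  obtain T where T: "\<And>k::nat. trace_class lam (T k)"
      and lim: "(\<lambda>k. hs_norm lam (\<lambda>f z. T k f z - A f z)) \<longlonglongrightarrow> 0"
    using trace_class_dense [OF A] by blast
  have FL: "F \<in> L2_mu lam" and HL: "H \<in> L2_mu lam"
    using F H by (auto simp: is_weyl_L2_def)
  have W: "\<And>k. weyl_trace lam (T k) \<in> L2_mu lam"
    and WF: "(\<lambda>k. L2_mu_norm lam (\<lambda>z. weyl_trace lam (T k) z - F z)) \<longlonglongrightarrow> 0"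
    and WH: "(\<lambda>k. L2_mu_norm lam (\<lambda>z. weyl_trace lam (T k) z - H z)) \<longlonglongrightarrow> 0"
    using F H T lim unfolding is_weyl_L2_def by blast+
  let ?d = "\<lambda>F k z. weyl_trace lam (T k) z - F z"
  \<comment> \<open>F - H is the difference of the two approximation errors, and its norm does not
    depend on k.\<close>
  have "(L2_mu_norm lam (\<lambda>z. F z - H z))\<^sup>2 \<le>
      2 * (L2_mu_norm lam (?d H k))\<^sup>2 + 2 * (L2_mu_norm lam (?d F k))\<^sup>2" for k
    using L2_mu_diff(2) [OF L2_mu_diff(1) [OF W HL] L2_mu_diff(1) [OF W FL], of k k] by simp
  moreover have "(\<lambda>k. 2 * (L2_mu_norm lam (?d H k))\<^sup>2 + 2 * (L2_mu_norm lam (?d F k))\<^sup>2)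
      \<longlonglongrightarrow> 2 * 0\<^sup>2 + 2 * 0\<^sup>2"
    by (intro tendsto_intros WF WH)
  ultimately have "(L2_mu_norm lam (\<lambda>z. F z - H z))\<^sup>2 \<le> 2 * 0\<^sup>2 + 2 * 0\<^sup>2"
    by (intro LIMSEQ_le_const) auto
  then have "L2_mu_norm lam (\<lambda>z. F z - H z) = 0" by simp
  from L2_mu_norm_zero_AE [OF L2_mu_diff(1) [OF FL HL] this] show ?thesis by simp
qed

section \<open>The representation of the diamond group\<close>

lemma cdot_vcnj_left: "cdot (vcnj a) b = cdot b (vcnj a)"
  by (rule cdot_commute)

lemma cdot_diff_left: "cdot (x - y) w = cdot x w - cdot y w"
  by (simp add: cdot_def left_diff_distrib sum_subtractf)

lemma vcnj_diff: "vcnj (x - y) = vcnj x - vcnj y"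
  by (simp add: vcnj_def vec_eq_iff)

lemma cdot_scaleR_left: "cdot (r *\<^sub>R x) w = of_real r * cdot x w"
proof -
  have "(r *\<^sub>R x) $ k = complex_of_real r * x $ k" for k
    unfolding vector_scaleR_component by (rule scaleR_conv_of_real)
  then show ?thesis by (simp add: cdot_def sum_distrib_left mult.assoc)
qed

lemma vcnj_scaleR: "vcnj (r *\<^sub>R x) = r *\<^sub>R vcnj x"
  by (simp add: vcnj_def vec_eq_iff)

lemma cnj_cdot_vcnj: "cnj (cdot a (vcnj b)) = cdot b (vcnj a)"
  by (simp add: cdot_def vcnj_def mult.commute)

lemma cdot_torus_act_vcnj: "cdot (torus_act \<alpha> t a) (vcnj (torus_act \<alpha> t b)) = cdot a (vcnj b)"
proof -
  have *: "exp (\<i> * complex_of_real r) * cnj (exp (\<i> * complex_of_real r)) = 1" for r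
    by (simp only: mult_cnj_cmod norm_exp_i_times) simp
  have "exp (\<i> * complex_of_real r) * x * cnj (exp (\<i> * complex_of_real r) * y) = x * cnj y" for r x y
    using * [of r] by (simp add: mult_ac)
  then show ?thesis
    unfolding cdot_def vcnj_def torus_act_def vec_lambda_beta by (intro sum.cong refl)
qed

lemma torus_act_smult: "torus_act \<alpha> t (c *s v) = c *s torus_act \<alpha> t v"
  by (simp add: torus_act_def vec_eq_iff mult_ac)

lemma torus_act_scaleR: "torus_act \<alpha> t (r *\<^sub>R v) = r *\<^sub>R torus_act \<alpha> t v"
  by (simp add: torus_act_def vec_eq_iff)

lemma linear_torus_act: "linear (torus_act \<alpha> t)"
  by (rule linearI) (simp_all add: torus_act_plus torus_act_scaleR)

lemma orthogonal_torus_act: "orthogonal_transformation (torus_act \<alpha> t)"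
  by (simp add: orthogonal_transformation linear_torus_act norm_torus_act)

lemma measurable_torus_act [measurable]: "torus_act \<alpha> t \<in> borel_measurable borel"
  using linear_torus_act [of \<alpha> t]
  by (simp add: borel_measurable_continuous_onI linear_continuous_on linear_linear)

lemma torus_act_measurable_mu: "(\<lambda>z. torus_act \<alpha> t (z - v)) \<in> mu lam \<rightarrow>\<^sub>M mu lam"
  by (simp add: mu_def)

lemma integral_mu_torus_act:
  fixes F :: "complex^'n \<Rightarrow> 'b::{banach, second_countable_topology}"
  assumes "F \<in> borel_measurable borel"
  shows "(LINT z|mu lam. F (torus_act \<alpha> t (z - v))) = (LINT z|mu lam. F z)"
proof -
  have "(LINT z|distr (mu lam) (mu lam) (\<lambda>z. torus_act \<alpha> t (z - v)). F z) =
      (LINT z|mu lam. F (torus_act \<alpha> t (z - v)))"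
    using assms by (intro integral_distr torus_act_measurable_mu) simp
  then show ?thesis by (simp add: distr_mu [OF orthogonal_torus_act])
qed

lemma integrable_mu_torus_act:
  fixes F :: "complex^'n \<Rightarrow> 'b::{banach, second_countable_topology}"
  assumes "integrable (mu lam) F"
  shows "integrable (mu lam) (\<lambda>z. F (torus_act \<alpha> t (z - v)))"
  by (rule integrable_distr [OF torus_act_measurable_mu])
    (simp add: distr_mu [OF orthogonal_torus_act] assms)

section \<open>Unitarity of the representation\<close>

lemma Re_cdot_vcnj: "Re (cdot (vcnj a) b) = inner a b"
  by (simp add: cdot_def vcnj_def inner_vec_def inner_complex_def)

text \<open>The central term is purely imaginary and \<open>chi t\<close> has modulus 1, so only the
  real part of the exponent matters: twice it, minus lambda |z|^2 / 2, is the completed square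
  -lambda |z - z0|^2 / 2. Membership in the Fock space and inner products thereby reduce to
  invariance of \<open>mu\<close>.\<close>

lemma diamond_rep_weight:
  assumes "norm (chi t) = 1"
  shows "diamond_rep lam \<alpha> chi (t, z0, c0) f z * cnj (diamond_rep lam \<alpha> chi (t, z0, c0) h z)
      * complex_of_real (exp (- lam * (norm z)\<^sup>2 / 2)) =
    f (torus_act \<alpha> (- t) (z - z0)) * cnj (h (torus_act \<alpha> (- t) (z - z0)))
      * complex_of_real (exp (- lam * (norm (torus_act \<alpha> (- t) (z - z0)))\<^sup>2 / 2))"
proof -
  define w where "w = \<i> * complex_of_real lam * complex_of_real c0
          + complex_of_real lam / 2 * cdot (vcnj z0) z
          - complex_of_real lam / 4 * complex_of_real ((norm z0)\<^sup>2)"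
  have Rw: "Re w = lam / 2 * inner z0 z - lam / 4 * (norm z0)\<^sup>2"
    by (simp add: w_def Re_cdot_vcnj flip: of_real_power)
  have n: "(norm (z - z0))\<^sup>2 = (norm z)\<^sup>2 - 2 * inner z0 z + (norm z0)\<^sup>2"
    by (simp add: power2_norm_eq_inner inner_diff_left inner_diff_right inner_commute [of z z0])
  have "(cmod (exp w))\<^sup>2 * exp (- lam * (norm z)\<^sup>2 / 2) = exp (2 * Re w + - lam * (norm z)\<^sup>2 / 2)"
    unfolding exp_add norm_exp_eq_Re by (simp only: exp_double)
  also have "2 * Re w + - lam * (norm z)\<^sup>2 / 2 = - lam * (norm (z - z0))\<^sup>2 / 2"
    unfolding Rw n by (simp add: algebra_simps add_divide_distrib diff_divide_distrib)
  finally have "(cmod (exp w))\<^sup>2 * exp (- lam * (norm z)\<^sup>2 / 2) = exp (- lam * (norm (z - z0))\<^sup>2 / 2)" .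
  then have E: "exp w * cnj (exp w) * complex_of_real (exp (- lam * (norm z)\<^sup>2 / 2)) =
      complex_of_real (exp (- lam * (norm (z - z0))\<^sup>2 / 2))"
    by (simp only: mult_cnj_cmod of_real_mult [symmetric])
  have C: "chi t * cnj (chi t) = 1"
    by (simp add: mult_cnj_cmod assms)
  let ?x = "f (torus_act \<alpha> (- t) (z - z0))" and ?y = "h (torus_act \<alpha> (- t) (z - z0))"
  have "(chi t * exp w * ?x) * cnj (chi t * exp w * ?y) * complex_of_real (exp (- lam * (norm z)\<^sup>2 / 2))
      = (chi t * cnj (chi t)) * ?x * cnj ?y *
        (exp w * cnj (exp w) * complex_of_real (exp (- lam * (norm z)\<^sup>2 / 2)))"
    by (simp only: complex_cnj_mult mult_ac)
  then show ?thesis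
    unfolding C E by (simp add: diamond_rep_def w_def norm_torus_act)
qed

lemma holomorphic_diamond_rep:
  assumes "holomorphic_Cn f"
  shows "holomorphic_Cn (diamond_rep lam \<alpha> chi g f)"
proof -
  obtain t z0 c0 where g: "g = (t, z0, c0)" by (cases g)
  let ?b = "\<i> * complex_of_real lam * complex_of_real c0
    - complex_of_real lam / 4 * complex_of_real ((norm z0)\<^sup>2)"
  have "holomorphic_Cn (\<lambda>z. chi t * exp (?b + complex_of_real lam / 2 * cdot (vcnj z0) z) *
      f (torus_act \<alpha> (- t) (z - z0)))"
    by (intro holomorphic_Cn_mult holomorphic_Cn_const holomorphic_Cn_exp_cdot
        holomorphic_Cn_compose_affine assms linear_torus_act torus_act_smult)
  then show ?thesis
    by (simp add: g diamond_rep_def algebra_simps)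
qed

text \<open>Stated outside the locale below, so that it also covers the artificial characters used
  for \<open>Omega0\<close>.\<close>

lemma fock_diamond_rep:
  fixes \<alpha> :: "'n::finite \<Rightarrow> real^'m::finite \<Rightarrow> real"
  assumes chi: "\<And>t. norm (chi t) = 1" and f: "f \<in> fock lam"
  shows "diamond_rep lam \<alpha> chi g f \<in> fock lam"
proof -
  obtain t z0 c0 where g: "g = (t, z0, c0)" by (cases g)
  let ?F = "\<lambda>f z. (norm (f z))\<^sup>2 * exp (- lam * (norm z)\<^sup>2 / 2)"
  have n: "?F f z = cmod (f z * cnj (f z) * complex_of_real (exp (- lam * (norm z)\<^sup>2 / 2)))"
    for f :: "complex^'n \<Rightarrow> complex" and z
    by (simp add: norm_mult power2_eq_square)
  have "?F (diamond_rep lam \<alpha> chi g f) z = ?F f (torus_act \<alpha> (- t) (z - z0))" for z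
    unfolding n g diamond_rep_weight [OF chi] ..
  moreover have "integrable (mu lam) (\<lambda>z. ?F f (torus_act \<alpha> (- t) (z - z0)))"
    by (rule integrable_mu_torus_act [OF fock_integrable [OF f]])
  ultimately show ?thesis
    using fock_holomorphic [OF f] unfolding fock_def by (simp add: holomorphic_diamond_rep)
qed

lemma fock_inner_diamond_rep:
  assumes chi: "\<And>t. norm (chi t) = 1" and f: "f \<in> fock lam" and h: "h \<in> fock lam"
  shows "fock_inner lam (diamond_rep lam \<alpha> chi g f) (diamond_rep lam \<alpha> chi g h) = fock_inner lam f h"
proof -
  obtain t z0 c0 where g: "g = (t, z0, c0)" by (cases g)
  note [measurable] = fock_measurable [OF f] fock_measurable [OF h]
  show ?thesis
    unfolding fock_inner_def g diamond_rep_weight [OF chi]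
    by (rule integral_mu_torus_act) measurable
qed

lemma diamond_rep_add:
  "diamond_rep lam \<alpha> chi g (\<lambda>z. f z + h z) =
    (\<lambda>z. diamond_rep lam \<alpha> chi g f z + diamond_rep lam \<alpha> chi g h z)"
  by (cases g) (simp add: diamond_rep_def distrib_left fun_eq_iff)

lemma diamond_rep_scale:
  "diamond_rep lam \<alpha> chi g (\<lambda>z. c * f z) = (\<lambda>z. c * diamond_rep lam \<alpha> chi g f z)"
  by (cases g) (simp add: diamond_rep_def fun_eq_iff mult_ac)

lemma diamond_rep_diff:
  "diamond_rep lam \<alpha> chi g (\<lambda>z. f z - h z) =
    (\<lambda>z. diamond_rep lam \<alpha> chi g f z - diamond_rep lam \<alpha> chi g h z)"
  by (cases g) (simp add: diamond_rep_def right_diff_distrib fun_eq_iff)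

text \<open>Up to the factor \<open>2 ^ n\<close>, the operator \<open>Omega0\<close> is itself of the form \<open>diamond_rep\<close>, for
  characters acting as \<open>- 1\<close>.\<close>

lemma fock_Omega0:
  assumes f: "f \<in> fock lam"
  shows "Omega0 lam z f \<in> fock lam"
proof -
  \<comment> \<open>A constant instead of a linear form, so that even t = 0 acts as exp(i pi) = -1.
    With translation part 2 z the argument becomes -(w - 2 z), and lambda/2 and lambda/4 grow to the
    coefficients lambda of \<open>Omega0\<close>.\<close>
  define \<alpha> :: "'a \<Rightarrow> real^1 \<Rightarrow> real" where "\<alpha> = (\<lambda>_ _. pi)"
  have t: "torus_act \<alpha> s w = - w" for s w
    by (simp add: torus_act_def \<alpha>_def vec_eq_iff)
  have "Omega0 lam z f =
      (\<lambda>w. 2 ^ CARD('a) * diamond_rep lam \<alpha> (\<lambda>_. 1) (0, 2 *\<^sub>R z, 0) f w)"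
    by (rule ext) (simp add: Omega0_def diamond_rep_def t vcnj_scaleR cdot_scaleR_left
        cdot_vcnj_left cdot_commute [of _ "2 *\<^sub>R vcnj z"] cdot_commute [of "vcnj z"] algebra_simps power_mult_distrib)
  moreover have "\<dots> \<in> fock lam"
    by (intro fock_scale fock_diamond_rep f) simp
  ultimately show ?thesis by simp
qed

text \<open>The torus element crosses the pairing to act on w. The x-dependent terms then merge into
  the pairing with the conjugate of t.w + z0, and what is left is the scalar factor.\<close>

lemma diamond_rep_coherent:
  assumes lin: "\<And>k. linear (\<alpha> k)"
  shows "diamond_rep lam \<alpha> chi (t, z0, c0) (coherent lam w) =
    (\<lambda>x. chi t * exp (\<i> * complex_of_real lam * complex_of_real c0
          - complex_of_real lam / 4 * complex_of_real ((norm z0)\<^sup>2)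
          - complex_of_real lam / 2 * cdot z0 (vcnj (torus_act \<alpha> t w))) *
      coherent lam (diamond_act \<alpha> (t, z0, c0) w) x)"
proof
  fix x
  let ?l = "complex_of_real lam"
  have "\<i> * ?l * complex_of_real c0 + ?l / 2 * cdot (vcnj z0) x - ?l / 4 * complex_of_real ((norm z0)\<^sup>2)
        + ?l * cdot (vcnj w) (torus_act \<alpha> (- t) (x - z0)) / 2 =
      \<i> * ?l * complex_of_real c0 - ?l / 4 * complex_of_real ((norm z0)\<^sup>2)
        - ?l / 2 * cdot z0 (vcnj (torus_act \<alpha> t w)) + ?l * cdot (vcnj (torus_act \<alpha> t w + z0)) x / 2"
    by (simp only: cdot_torus_act [OF lin] cdot_diff_right vcnj_add cdot_add_left
        cdot_commute [of z0 "vcnj (torus_act \<alpha> t w)"])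
      (simp add: field_simps)
  then show "diamond_rep lam \<alpha> chi (t, z0, c0) (coherent lam w) x =
      chi t * exp (\<i> * ?l * complex_of_real c0 - ?l / 4 * complex_of_real ((norm z0)\<^sup>2)
          - ?l / 2 * cdot z0 (vcnj (torus_act \<alpha> t w))) *
      coherent lam (diamond_act \<alpha> (t, z0, c0) w) x"
    by (simp only: diamond_rep_def coherent_def diamond_act_def prod.case mult.assoc exp_add [symmetric])
qed

text \<open>\<open>Omega0\<close> is a multiple of a point reflection, whose centre z is carried
  along by the affine motion g. The exponents agree because both Gaussian factors expand around the
  same point p + z0.\<close>

lemma diamond_rep_Omega0:
  assumes lin: "\<And>k. linear (\<alpha> k)"
  shows "diamond_rep lam \<alpha> chi g (Omega0 lam z f) =
    Omega0 lam (diamond_act \<alpha> g z) (diamond_rep lam \<alpha> chi g f)"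
proof
  fix w
  obtain t z0 c0 where g: "g = (t, z0, c0)" by (cases g)
  define p where "p = torus_act \<alpha> t z"
  have inv: "torus_act \<alpha> (- t) p = z"
    by (simp add: p_def torus_act_add [OF lin, symmetric] torus_act_0 [OF lin])
  have arg: "torus_act \<alpha> (- t) (2 *\<^sub>R (p + z0) - w - z0) = 2 *\<^sub>R z - torus_act \<alpha> (- t) (w - z0)"
  proof -
    have "2 *\<^sub>R (p + z0) - w - z0 = 2 *\<^sub>R p - (w - z0)"
      by (simp add: scaleR_2)
    then show ?thesis by (simp only: torus_act_minus torus_act_scaleR inv)
  qed
  let ?l = "complex_of_real lam"
  have e1: "cdot (torus_act \<alpha> (- t) (w - z0)) (vcnj z) = cdot w (vcnj p) - cdot z0 (vcnj p)"
    by (simp only: cdot_commute [of _ "vcnj z"] cdot_torus_act [OF lin] p_def [symmetric] cdot_diff_right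
       cdot_commute [of "vcnj p"])
  have e2: "complex_of_real ((norm (p + z0))\<^sup>2) = complex_of_real ((norm z)\<^sup>2)
      + cdot p (vcnj z0) + cdot z0 (vcnj p) + complex_of_real ((norm z0)\<^sup>2)"
    by (simp only: cdot_vcnj [symmetric] vcnj_add cdot_add_left cdot_add_right
        p_def cdot_torus_act_vcnj add_ac)
  have e3: "cdot (vcnj z0) (2 *\<^sub>R (p + z0) - w) =
      2 * cdot p (vcnj z0) + 2 * complex_of_real ((norm z0)\<^sup>2) - cdot w (vcnj z0)"
    by (simp only: cdot_vcnj_left cdot_diff_left cdot_scaleR_left cdot_add_left cdot_vcnj
        of_real_numeral distrib_left)
  have ex: "\<i> * ?l * complex_of_real c0 + ?l / 2 * cdot (vcnj z0) w - ?l / 4 * complex_of_real ((norm z0)\<^sup>2)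
        + ?l * (cdot (torus_act \<alpha> (- t) (w - z0)) (vcnj z) - complex_of_real ((norm z)\<^sup>2)) =
      ?l * (cdot w (vcnj (p + z0)) - complex_of_real ((norm (p + z0))\<^sup>2)) +
      (\<i> * ?l * complex_of_real c0 + ?l / 2 * cdot (vcnj z0) (2 *\<^sub>R (p + z0) - w)
        - ?l / 4 * complex_of_real ((norm z0)\<^sup>2))"
    unfolding e1 e2 e3 vcnj_add cdot_add_right cdot_vcnj_left [of z0 w]
    by (simp add: field_simps)
  have "diamond_rep lam \<alpha> chi g (Omega0 lam z f) w = chi t * 2 ^ CARD('a) *
      exp (\<i> * ?l * complex_of_real c0 + ?l / 2 * cdot (vcnj z0) w - ?l / 4 * complex_of_real ((norm z0)\<^sup>2)
        + ?l * (cdot (torus_act \<alpha> (- t) (w - z0)) (vcnj z) - complex_of_real ((norm z)\<^sup>2))) *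
      f (2 *\<^sub>R z - torus_act \<alpha> (- t) (w - z0))"
    by (simp only: g diamond_rep_def Omega0_def prod.case exp_add mult_ac)
  also have "\<dots> = Omega0 lam (diamond_act \<alpha> g z) (diamond_rep lam \<alpha> chi g f) w"
    unfolding ex arg [symmetric]
    by (simp only: g diamond_rep_def Omega0_def diamond_act_def prod.case exp_add p_def mult_ac)
  finally show "diamond_rep lam \<alpha> chi g (Omega0 lam z f) w =
      Omega0 lam (diamond_act \<alpha> g z) (diamond_rep lam \<alpha> chi g f) w" .
qed

lemma torus_act_uminus: "torus_act \<alpha> t (- z) = - torus_act \<alpha> t z"
  by (simp add: torus_act_def vec_eq_iff)

text \<open>Hence the central coordinate of a group inverse is just -c.\<close>

lemma omega_neg: "omega (z, vcnj z) (- z, vcnj (- z)) = 0"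
proof -
  have "vcnj (- z) = - vcnj z" by (simp add: vcnj_def vec_eq_iff)
  then show ?thesis by (simp add: omega_def cdot_def)
qed

lemma trace_class_fock:
  assumes "trace_class lam A" "f \<in> fock lam"
  shows "A f \<in> fock lam"
proof -
  obtain B C where B: "hilbert_schmidt lam B" and C: "hilbert_schmidt lam C"
      and A: "\<forall>f\<in>fock lam. A f = B (C f)"
    using assms(1) unfolding trace_class_def by (elim exE conjE) (rule that)
  note B' = fock_operatorD(5) [OF B [unfolded hilbert_schmidt_def, THEN conjunct1]]
  note C' = fock_operatorD(5) [OF C [unfolded hilbert_schmidt_def, THEN conjunct1]]
  show ?thesis
    unfolding bspec [OF A assms(2)] by (rule B' [OF C' [OF assms(2)]])
qed

section \<open>The operators attached to group elements\<close>

locale diamond_setting =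
  fixes lam :: real
    and \<alpha> :: "'n::finite \<Rightarrow> real^'m::finite \<Rightarrow> real"
    and chi :: "real^'m \<Rightarrow> complex"
  assumes lin: "\<And>k. linear (\<alpha> k)"
    and character: "unitary_character chi"
begin

abbreviation U :: "('m, 'n) diamond \<Rightarrow> (complex^'n \<Rightarrow> complex) \<Rightarrow> complex^'n \<Rightarrow> complex" where
  "U \<equiv> diamond_rep lam \<alpha> chi"

abbreviation act :: "('m, 'n) diamond \<Rightarrow> complex^'n \<Rightarrow> complex^'n" where
  "act \<equiv> diamond_act \<alpha>"

abbreviation conj_by :: "('m, 'n) diamond \<Rightarrow> ((complex^'n \<Rightarrow> complex) \<Rightarrow> complex^'n \<Rightarrow> complex) \<Rightarrow>
    (complex^'n \<Rightarrow> complex) \<Rightarrow> complex^'n \<Rightarrow> complex" where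
  "conj_by \<equiv> conj_op lam \<alpha> chi"

definition ginv :: "('m, 'n) diamond \<Rightarrow> ('m, 'n) diamond" where
  "ginv = (\<lambda>(t, z, c). (- t, - torus_act \<alpha> (- t) z, - c))"

lemma norm_chi: "norm (chi t) = 1"
  using character by (simp add: unitary_character_def)

lemma chi_0: "chi 0 = 1"
proof -
  have "chi (0 + 0) = chi 0 * chi 0"
    using character unfolding unitary_character_def by blast
  moreover have "chi 0 \<noteq> 0" using norm_chi [of 0] by auto
  ultimately show ?thesis by simp
qed

lemma torus_act_cancel: "torus_act \<alpha> t (torus_act \<alpha> (- t) z) = z" "torus_act \<alpha> (- t) (torus_act \<alpha> t z) = z"
  by (simp_all add: torus_act_add [OF lin, symmetric] torus_act_0 [OF lin])

lemma ginv: "diamond_mult \<alpha> g (ginv g) = (0, 0, 0)" "diamond_mult \<alpha> (ginv g) g = (0, 0, 0)"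
proof -
  obtain t z c where g: "g = (t, z, c)" by (cases g)
  show "diamond_mult \<alpha> g (ginv g) = (0, 0, 0)"
    by (simp add: g ginv_def diamond_mult_def torus_act_uminus torus_act_cancel omega_neg)
  show "diamond_mult \<alpha> (ginv g) g = (0, 0, 0)"
    using omega_neg [of "- torus_act \<alpha> (- t) z"]
    by (simp add: g ginv_def diamond_mult_def torus_act_cancel)
qed

lemma U_0: "U (0, 0, 0) f = f"
  by (rule ext) (simp add: diamond_rep_def chi_0 torus_act_0 [OF lin] cdot_def vcnj_def)

lemma U_ginv: "U g (U (ginv g) f) = f" "U (ginv g) (U g f) = f"
  by (simp_all only: diamond_rep_mult [OF lin character, symmetric] ginv U_0)

lemma act_ginv: "act g (act (ginv g) z) = z" "act (ginv g) (act g z) = z"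
  by (simp_all only: diamond_act_mult [OF lin, symmetric] ginv)
    (simp_all add: diamond_act_def torus_act_0 [OF lin])

lemma fock_U: "f \<in> fock lam \<Longrightarrow> U g f \<in> fock lam"
  by (rule fock_diamond_rep [OF norm_chi])

lemma inner_U: "f \<in> fock lam \<Longrightarrow> h \<in> fock lam \<Longrightarrow> fock_inner lam (U g f) (U g h) = fock_inner lam f h"
  by (rule fock_inner_diamond_rep [OF norm_chi])

lemma norm_U: "f \<in> fock lam \<Longrightarrow> fock_norm lam (U g f) = fock_norm lam f"
  by (simp add: fock_norm_def inner_U)

lemma inj_U: "inj (U g)"
  by (rule inj_on_inverseI [of _ "U (ginv g)"]) (rule U_ginv)

text \<open>\<open>inv_into\<close> is a true inverse only on the image of the Fock space; the
  hypothesis places \<open>A (U g f)\<close> there, its preimage being the right-hand side.\<close>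

lemma conj_eq:
  assumes "A (U g f) \<in> fock lam"
  shows "conj_by g A f = U (ginv g) (A (U g f))"
proof -
  have "inv_into (fock lam) (U g) (U g (U (ginv g) (A (U g f)))) = U (ginv g) (A (U g f))"
    by (rule inv_into_f_f [OF inj_on_subset [OF inj_U subset_UNIV] fock_U [OF assms]])
  then show ?thesis by (simp only: conj_op_def U_ginv)
qed

lemma U_conj:
  assumes "A (U g f) \<in> fock lam"
  shows "U g (conj_by g A f) = A (U g f)"
  by (simp only: conj_eq [of A, OF assms] U_ginv)

section \<open>Conjugated operators\<close>

lemma fock_operator_conj:
  assumes A: "fock_operator lam D A"
  shows "fock_operator lam (conj_dom lam \<alpha> chi g D) (conj_by g A)"
proof -
  note A = fock_operatorD [OF A]
  have D: "f \<in> conj_dom lam \<alpha> chi g D \<longleftrightarrow> f \<in> fock lam \<and> U g f \<in> D" for f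
    by (simp add: conj_dom_def)
  have U0: "U g (\<lambda>_. 0) = (\<lambda>_. 0)"
    using diamond_rep_scale [of lam \<alpha> chi g 0 "\<lambda>_. 0"] by simp
  show ?thesis
    unfolding fock_operator_def
  proof (intro conjI ballI allI)
    show "conj_dom lam \<alpha> chi g D \<subseteq> fock lam" by (simp add: conj_dom_def)
    show "(\<lambda>_. 0) \<in> conj_dom lam \<alpha> chi g D" by (simp add: D fock_zero U0 A(2))
    fix f assume f: "f \<in> conj_dom lam \<alpha> chi g D"
    then have f': "f \<in> fock lam" "U g f \<in> D" by (simp_all add: D)
    have cf: "conj_by g A f = U (ginv g) (A (U g f))"
      by (rule conj_eq [of A, OF A(5) [OF f'(2)]])
    show "conj_by g A f \<in> fock lam"
      unfolding cf by (rule fock_U [OF A(5) [OF f'(2)]])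
    fix c
    have s: "U g (\<lambda>z. c * f z) \<in> D"
      unfolding diamond_rep_scale by (rule A(4) [OF f'(2)])
    then show "(\<lambda>z. c * f z) \<in> conj_dom lam \<alpha> chi g D"
      by (simp add: D fock_scale f')
    show "conj_by g A (\<lambda>z. c * f z) = (\<lambda>z. c * conj_by g A f z)"
      unfolding cf conj_eq [of A, OF A(5) [OF s]] unfolding diamond_rep_scale A(7) [OF f'(2)] ..
  next
    fix f h assume f: "f \<in> conj_dom lam \<alpha> chi g D" and h: "h \<in> conj_dom lam \<alpha> chi g D"
    then have f': "f \<in> fock lam" "U g f \<in> D" and h': "h \<in> fock lam" "U g h \<in> D"
      by (simp_all add: D)
    have s: "U g (\<lambda>z. f z + h z) \<in> D"
      unfolding diamond_rep_add by (rule A(3) [OF f'(2) h'(2)])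
    then show "(\<lambda>z. f z + h z) \<in> conj_dom lam \<alpha> chi g D"
      by (simp add: D fock_add f' h')
    show "conj_by g A (\<lambda>z. f z + h z) = (\<lambda>z. conj_by g A f z + conj_by g A h z)"
      unfolding conj_eq [of A, OF A(5) [OF s]] conj_eq [of A, OF A(5) [OF f'(2)]] conj_eq [of A, OF A(5) [OF h'(2)]]
      unfolding diamond_rep_add A(6) [OF f'(2) h'(2)] ..
  qed
qed

lemma conj_dom_fock: "conj_dom lam \<alpha> chi g (fock lam) = fock lam"
  by (auto simp: conj_dom_def fock_U)

lemma fock_bounded_conj:
  assumes A: "fock_bounded lam A"
  shows "fock_bounded lam (conj_by g A)"
proof -
  note Aop = fock_boundedD(1) [OF A]
  obtain K where K: "\<forall>f\<in>fock lam. fock_norm lam (A f) \<le> K * fock_norm lam f"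
    using fock_boundedD(2) [OF A] by blast
  have "fock_norm lam (conj_by g A f) \<le> K * fock_norm lam f" if f: "f \<in> fock lam" for f
    using bspec [OF K fock_U [OF f]] fock_operatorD(5) [OF Aop fock_U [OF f]]
    by (simp add: conj_eq norm_U f)
  moreover have "fock_operator lam (fock lam) (conj_by g A)"
    using fock_operator_conj [OF Aop] by (simp only: conj_dom_fock)
  ultimately show ?thesis
    unfolding fock_bounded_def by (intro conjI exI [of _ K] ballI)
qed

section \<open>Invariance of bases, traces and Hilbert-Schmidt norms\<close>

lemma orthonormal_basis_U:
  assumes E: "orthonormal_basis lam E"
  shows "orthonormal_basis lam (U g ` E)"
proof -
  note E' = orthonormal_basisD [OF E]
  have U_sum: "U h (\<lambda>z. \<Sum>e\<in>S. c e * e z) = (\<lambda>z. \<Sum>e\<in>S. c e * U h e z)"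
    if "finite S" for h S and c :: "(complex^'n \<Rightarrow> complex) \<Rightarrow> complex"
  proof -
    obtain t z0 c0 where h: "h = (t, z0, c0)" by (cases h)
    show ?thesis
      unfolding h diamond_rep_def prod.case sum_distrib_left
      by (intro ext sum.cong refl) (simp only: mult_ac)
  qed
  show ?thesis
    unfolding orthonormal_basis_def
  proof (intro conjI ballI allI impI)
    show "U g ` E \<subseteq> fock lam" using E'(1) fock_U by blast
  next
    fix e e' assume "e \<in> U g ` E" "e' \<in> U g ` E"
    then obtain a a' where a: "a \<in> E" "e = U g a" and a': "a' \<in> E" "e' = U g a'" by blast
    then have "fock_inner lam e e' = fock_inner lam a a'"
      using E'(1) by (simp add: inner_U subset_iff)
    moreover have "e = e' \<longleftrightarrow> a = a'" using a a' inj_U by (simp add: inj_eq)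
    ultimately show "fock_inner lam e e' = (if e = e' then 1 else 0)"
      using E'(2) a a' by simp
  next
    fix f :: "complex^'n \<Rightarrow> complex" and \<epsilon> :: real assume f: "f \<in> fock lam" and \<epsilon>: "\<epsilon> > 0"
    \<comment> \<open>The approximation is made for the preimage of f and carried over by the
      isometry \<open>U g\<close>; the coefficients are reindexed with \<open>ginv\<close>.\<close>
    obtain S c where S: "finite S" "S \<subseteq> E"
        and less: "fock_norm lam (\<lambda>z. U (ginv g) f z - (\<Sum>e\<in>S. c e * e z)) < \<epsilon>"
      using E'(3) [OF fock_U [OF f] \<epsilon>] by blast
    have SF: "S \<subseteq> fock lam" using S E'(1) by blast
    have "fock_norm lam (U g (\<lambda>z. U (ginv g) f z - (\<Sum>e\<in>S. c e * e z))) < \<epsilon>"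
      using less by (subst norm_U [OF fock_diff [OF fock_U [OF f] fock_sum [OF S(1) SF]]])
    moreover have "U g (\<lambda>z. U (ginv g) f z - (\<Sum>e\<in>S. c e * e z)) =
        (\<lambda>z. f z - (\<Sum>e\<in>U g ` S. c (U (ginv g) e) * e z))"
      unfolding diamond_rep_diff U_ginv U_sum [OF S(1)]
      by (simp add: sum.reindex [OF inj_on_subset [OF inj_U subset_UNIV]] U_ginv)
    ultimately show "\<exists>S c. finite S \<and> S \<subseteq> U g ` E \<and>
        fock_norm lam (\<lambda>z. f z - (\<Sum>e\<in>S. c e * e z)) < \<epsilon>"
      using S by (intro exI [of _ "U g ` S"] exI [of _ "\<lambda>e. c (U (ginv g) e)"]) auto
  qed
qed

text \<open>E -> \<open>U g\<close> E is a bijection of the set of orthonormal bases. The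
  equivalence is stated for the predicates under the definite descriptions in
  \<open>op_trace\<close> and \<open>hs_norm\<close>, so it applies before anything is known about
  existence of s.\<close>

lemma orthonormal_basis_sum_invariant:
  "(\<forall>E. orthonormal_basis lam E \<longrightarrow> ((\<lambda>e. F (U g e)) has_sum s) E) \<longleftrightarrow>
   (\<forall>E. orthonormal_basis lam E \<longrightarrow> (F has_sum s) E)"
proof -
  have re: "(F has_sum s) (U g ` E) \<longleftrightarrow> ((\<lambda>e. F (U g e)) has_sum s) E" for E
    by (subst has_sum_reindex [OF inj_on_subset [OF inj_U subset_UNIV]]) (simp add: comp_def)
  have im: "U g ` U (ginv g) ` E = E" for E
    by (simp add: image_image U_ginv)
  show ?thesis
    using re im orthonormal_basis_U by metis
qed

lemma op_trace_invariant:
  assumes "\<And>f. f \<in> fock lam \<Longrightarrow> B f \<in> fock lam"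
    and "\<And>f. f \<in> fock lam \<Longrightarrow> U g (B' f) = B (U g f)"
    and "\<And>f. f \<in> fock lam \<Longrightarrow> B' f \<in> fock lam"
  shows "op_trace lam B' = op_trace lam B"
proof -
  have "((\<lambda>e. fock_inner lam (B' e) e) has_sum s) E \<longleftrightarrow>
      ((\<lambda>e. fock_inner lam (B (U g e)) (U g e)) has_sum s) E"
    if "orthonormal_basis lam E" for E s
  proof (rule has_sum_cong)
    fix e assume "e \<in> E"
    then have e: "e \<in> fock lam" using orthonormal_basisD(1) [OF that] by blast
    show "fock_inner lam (B' e) e = fock_inner lam (B (U g e)) (U g e)"
      using inner_U [OF assms(3) [OF e] e, of g] by (simp add: assms(2) [OF e])
  qed
  then have "(\<forall>E. orthonormal_basis lam E \<longrightarrow> ((\<lambda>e. fock_inner lam (B' e) e) has_sum s) E) \<longleftrightarrow>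
      (\<forall>E. orthonormal_basis lam E \<longrightarrow> ((\<lambda>e. fock_inner lam (B e) e) has_sum s) E)" for s
    unfolding orthonormal_basis_sum_invariant [of "\<lambda>e. fock_inner lam (B e) e" g s, symmetric]
    by simp
  then show ?thesis unfolding op_trace_def by simp
qed

lemma hs_norm_invariant:
  assumes "\<And>f. f \<in> fock lam \<Longrightarrow> fock_norm lam (B' f) = fock_norm lam (B (U g f))"
  shows "hs_norm lam B' = hs_norm lam B"
proof -
  have "((\<lambda>e. (fock_norm lam (B' e))\<^sup>2) has_sum s) E \<longleftrightarrow>
      ((\<lambda>e. (fock_norm lam (B (U g e)))\<^sup>2) has_sum s) E"
    if "orthonormal_basis lam E" for E s
    using orthonormal_basisD(1) [OF that] assms by (intro has_sum_cong) (simp add: subset_iff)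
  then have "(\<forall>E. orthonormal_basis lam E \<longrightarrow> ((\<lambda>e. (fock_norm lam (B' e))\<^sup>2) has_sum s) E) \<longleftrightarrow>
      (\<forall>E. orthonormal_basis lam E \<longrightarrow> ((\<lambda>e. (fock_norm lam (B e))\<^sup>2) has_sum s) E)" for s
    unfolding orthonormal_basis_sum_invariant [of "\<lambda>e. (fock_norm lam (B e))\<^sup>2" g s, symmetric]
    by simp
  then show ?thesis unfolding hs_norm_def by simp
qed

section \<open>Covariance of the symbol\<close>

lemma hilbert_schmidt_conj:
  assumes A: "hilbert_schmidt lam A"
  shows "hilbert_schmidt lam (conj_by g A)"
proof -
  have Ab: "fock_bounded lam A" using A by (simp add: hilbert_schmidt_iff)
  note Af = fock_operatorD(5) [OF fock_boundedD(1) [OF Ab]]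
  obtain E where E: "orthonormal_basis lam E"
      and sm: "(\<lambda>e. (fock_norm lam (A e))\<^sup>2) summable_on E"
    using A [unfolded hilbert_schmidt_iff, THEN conjunct2] by (elim exE conjE) (rule that)
  have "fock_norm lam (conj_by g A (U (ginv g) e)) = fock_norm lam (A e)" if "e \<in> E" for e
  proof -
    have "A e \<in> fock lam" using that orthonormal_basisD(1) [OF E] by (intro Af) blast
    then show ?thesis
      using conj_eq [of A g "U (ginv g) e"] by (simp only: U_ginv norm_U)
  qed
  then have "(\<lambda>e. (fock_norm lam (conj_by g A e))\<^sup>2) summable_on U (ginv g) ` E"
    unfolding summable_on_reindex [OF inj_on_subset [OF inj_U subset_UNIV]] comp_def
    using sm by (simp cong: summable_on_cong)
  then show ?thesis
    unfolding hilbert_schmidt_iff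
    by (intro conjI fock_bounded_conj [OF Ab] exI [of _ "U (ginv g) ` E"] orthonormal_basis_U [OF E])
qed

text \<open>Conjugation is multiplicative on the Fock space, so it maps a product of two
  Hilbert-Schmidt operators to such a product.\<close>

lemma trace_class_conj:
  assumes T: "trace_class lam A"
  shows "trace_class lam (conj_by g A)"
proof -
  obtain B C where B: "hilbert_schmidt lam B" and C: "hilbert_schmidt lam C"
      and A: "\<forall>f\<in>fock lam. A f = B (C f)"
    using T unfolding trace_class_def by (elim exE conjE) (rule that)
  note B' = fock_operatorD(5) [OF B [unfolded hilbert_schmidt_def, THEN conjunct1]]
  note C' = fock_operatorD(5) [OF C [unfolded hilbert_schmidt_def, THEN conjunct1]]
  have "conj_by g A f = conj_by g B (conj_by g C f)" if f: "f \<in> fock lam" for f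
  proof -
    have c: "U g (conj_by g C f) = C (U g f)"
      by (rule U_conj [of C, OF C' [OF fock_U [OF f]]])
    have a: "A (U g f) = B (C (U g f))" by (rule bspec [OF A fock_U [OF f]])
    have b: "B (C (U g f)) \<in> fock lam" by (rule B' [OF C' [OF fock_U [OF f]]])
    show ?thesis
      using conj_eq [of A g f] conj_eq [of B g "conj_by g C f"] b by (simp only: a c)
  qed
  then show ?thesis
    unfolding trace_class_def
    by (intro exI [of _ "conj_by g B"] exI [of _ "conj_by g C"] conjI hilbert_schmidt_conj B C ballI)
qed

lemma weyl_trace_conj:
  assumes T: "trace_class lam A"
  shows "weyl_trace lam (conj_by g A) z = weyl_trace lam A (act g z)"
  unfolding weyl_trace_def
proof (rule op_trace_invariant)
  fix f :: "complex^'n \<Rightarrow> complex" assume f: "f \<in> fock lam"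
  show "A (Omega0 lam (act g z) f) \<in> fock lam"
    by (rule trace_class_fock [OF T fock_Omega0 [OF f]])
  show "conj_by g A (Omega0 lam z f) \<in> fock lam"
    by (rule trace_class_fock [OF trace_class_conj [OF T] fock_Omega0 [OF f]])
  show "U g (conj_by g A (Omega0 lam z f)) = A (Omega0 lam (act g z) (U g f))"
    using U_conj [of A g "Omega0 lam z f", OF trace_class_fock [OF T fock_U [OF fock_Omega0 [OF f]]]]
    by (simp only: diamond_rep_Omega0 [OF lin])
qed

section \<open>Transport of the square-integrable symbol\<close>

lemma act_affine: "act (t, z0, c0) z = torus_act \<alpha> t (z - (- torus_act \<alpha> (- t) z0))"
  by (simp add: diamond_act_def torus_act_plus torus_act_cancel)

lemma L2_mu_act:
  assumes F: "F \<in> L2_mu lam"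
  shows "(\<lambda>z. F (act g z)) \<in> L2_mu lam"
    and "L2_mu_norm lam (\<lambda>z. F (act g z)) = L2_mu_norm lam F"
proof -
  obtain t z0 c0 where g: "g = (t, z0, c0)" by (cases g)
  have m [measurable]: "F \<in> borel_measurable borel"
    and i: "integrable (mu lam) (\<lambda>z. (norm (F z))\<^sup>2)"
    using F by (auto simp: L2_mu_def)
  have "integrable (mu lam) (\<lambda>z. (norm (F (act g z)))\<^sup>2)"
    unfolding g act_affine by (rule integrable_mu_torus_act [OF i])
  then show "(\<lambda>z. F (act g z)) \<in> L2_mu lam"
    unfolding g act_affine by (simp add: L2_mu_def)
  show "L2_mu_norm lam (\<lambda>z. F (act g z)) = L2_mu_norm lam F"
    unfolding L2_mu_norm_def g act_affine
    by (subst integral_mu_torus_act [of "\<lambda>z. (norm (F z))\<^sup>2"]) simp_all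
qed

text \<open>A test sequence for the conjugate of A is pulled back by the inverse of g to a test
  sequence for A, at the same Hilbert-Schmidt distances. The symbols of the two sequences differ by
  the motion g, which is an isometry of the square-integrable functions.\<close>

lemma is_weyl_L2_conj:
  assumes A: "hilbert_schmidt lam A" and F: "is_weyl_L2 lam A F"
  shows "is_weyl_L2 lam (conj_by g A) (\<lambda>z. F (act g z))"
proof -
  have FL: "F \<in> L2_mu lam" using F by (simp add: is_weyl_L2_def)
  note Af = fock_operatorD(5) [OF A [unfolded hilbert_schmidt_def, THEN conjunct1]]
  have "(\<forall>k. weyl_trace lam (T k) \<in> L2_mu lam) \<and>
      (\<lambda>k. L2_mu_norm lam (\<lambda>z. weyl_trace lam (T k) z - F (act g z))) \<longlonglongrightarrow> 0"
    if T: "\<forall>k::nat. trace_class lam (T k)"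
      and lim: "(\<lambda>k. hs_norm lam (\<lambda>f z. T k f z - conj_by g A f z)) \<longlonglongrightarrow> 0" for T
  proof -
    define T' where "T' k = conj_by (ginv g) (T k)" for k
    have T't: "trace_class lam (T' k)" for k
      unfolding T'_def by (rule trace_class_conj) (rule spec [OF T])
    have T'U: "T' k (U g f) = U g (T k f)" if f: "f \<in> fock lam" for k f
    proof -
      have "T k (U (ginv g) (U g f)) \<in> fock lam"
        unfolding U_ginv by (rule trace_class_fock [OF spec [OF T] f])
      from U_conj [of "T k", OF this] have "U (ginv g) (T' k (U g f)) = T k f"
        by (simp only: T'_def U_ginv)
      then have "U g (U (ginv g) (T' k (U g f))) = U g (T k f)" by simp
      then show ?thesis by (simp only: U_ginv)
    qed
    have "hs_norm lam (\<lambda>f z. T k f z - conj_by g A f z) = hs_norm lam (\<lambda>f z. T' k f z - A f z)" for k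
    proof (rule hs_norm_invariant [of _ _ g])
      fix f :: "complex^'n \<Rightarrow> complex" assume f: "f \<in> fock lam"
      have mem: "T k f \<in> fock lam" "conj_by g A f \<in> fock lam"
        using trace_class_fock [OF spec [OF T] f]
          fock_operatorD(5) [OF hilbert_schmidt_conj [OF A, unfolded hilbert_schmidt_def, THEN conjunct1] f]
        by simp_all
      have "(\<lambda>z. T' k (U g f) z - A (U g f) z) = U g (\<lambda>z. T k f z - conj_by g A f z)"
        by (simp only: diamond_rep_diff T'U [OF f] U_conj [of A, OF Af [OF fock_U [OF f]]])
      then show "fock_norm lam (\<lambda>z. T k f z - conj_by g A f z) =
          fock_norm lam (\<lambda>z. T' k (U g f) z - A (U g f) z)"
        using norm_U [OF fock_diff [OF mem]] by simp
    qed
    then have "(\<lambda>k. hs_norm lam (\<lambda>f z. T' k f z - A f z)) \<longlonglongrightarrow> 0" using lim by simp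
    then have W: "\<And>k. weyl_trace lam (T' k) \<in> L2_mu lam"
      and WF: "(\<lambda>k. L2_mu_norm lam (\<lambda>z. weyl_trace lam (T' k) z - F z)) \<longlonglongrightarrow> 0"
      using F T't unfolding is_weyl_L2_def by blast+
    have WT: "weyl_trace lam (T k) = (\<lambda>z. weyl_trace lam (T' k) (act g z))" for k
      by (rule ext) (simp only: T'_def weyl_trace_conj [OF spec [OF T]] act_ginv)
    show ?thesis
      unfolding WT using L2_mu_act [OF W] L2_mu_act(2) [OF L2_mu_diff(1) [OF W FL]] WF by simp
  qed
  then show ?thesis
    unfolding is_weyl_L2_def using L2_mu_act(1) [OF FL] by blast
qed

text \<open>Needed because conjugating by g and then by its inverse gives A back only on the Fock
  space. The identity element in \<open>hs_norm_invariant\<close> makes it a congruence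
  rule.\<close>

lemma is_weyl_L2_cong:
  fixes A A' :: "(complex^'n \<Rightarrow> complex) \<Rightarrow> complex^'n \<Rightarrow> complex"
  assumes "\<And>f. f \<in> fock lam \<Longrightarrow> A f = A' f"
  shows "is_weyl_L2 lam A F = is_weyl_L2 lam A' F"
proof -
  have "hs_norm lam (\<lambda>f z. T f z - A f z) = hs_norm lam (\<lambda>f z. T f z - A' f z)" for T
    by (rule hs_norm_invariant [of _ _ "(0, 0, 0)"]) (simp add: assms U_0)
  then show ?thesis unfolding is_weyl_L2_def by simp
qed

lemma conj_ginv_conj:
  assumes A: "\<And>f. f \<in> fock lam \<Longrightarrow> A f \<in> fock lam" and f: "f \<in> fock lam"
  shows "conj_by (ginv g) (conj_by g A) f = A f"
proof -
  let ?f = "U (ginv g) f"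
  have "A (U g ?f) \<in> fock lam" unfolding U_ginv by (rule A [OF f])
  from conj_eq [of A, OF this] have c: "conj_by g A ?f = U (ginv g) (A f)"
    by (simp only: U_ginv)
  have "conj_by g A ?f \<in> fock lam" unfolding c by (rule fock_U [OF A [OF f]])
  from U_conj [of "conj_by g A", OF this]
  have "U g (U (ginv g) (conj_by (ginv g) (conj_by g A) f)) = U g (U (ginv g) (A f))"
    by (simp only: c)
  then show ?thesis by (simp only: U_ginv)
qed

lemma weyl_L2_conj:
  assumes A: "hilbert_schmidt lam A"
  shows "AE z in mu lam. weyl_L2 lam (conj_by g A) z = weyl_L2 lam A (act g z)"
proof (cases "\<exists>F. is_weyl_L2 lam A F")
  case True
  then have "is_weyl_L2 lam A (weyl_L2 lam A)"
    unfolding weyl_L2_def by (simp add: someI_ex)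
  then have 1: "is_weyl_L2 lam (conj_by g A) (\<lambda>z. weyl_L2 lam A (act g z))"
    by (rule is_weyl_L2_conj [OF A])
  \<comment> \<open>The choice operator picks representatives for A and for its conjugate
    independently, so they can agree only almost everywhere, by uniqueness.\<close>
  then have ex: "\<exists>F. is_weyl_L2 lam (conj_by g A) F" by (rule exI [of "is_weyl_L2 lam (conj_by g A)"])
  then have "is_weyl_L2 lam (conj_by g A) (weyl_L2 lam (conj_by g A))"
    unfolding weyl_L2_def by (simp add: someI_ex)
  from is_weyl_L2_unique [OF hilbert_schmidt_conj [OF A] this 1] show ?thesis .
next
  case False
  \<comment> \<open>A symbol of the conjugate would transport back to one of A. So both sides take
    the default value 0.\<close>
  have "\<not> is_weyl_L2 lam (conj_by g A) F" for F
  proof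
    assume "is_weyl_L2 lam (conj_by g A) F"
    from is_weyl_L2_conj [OF hilbert_schmidt_conj [OF A] this, of "ginv g"]
    have "is_weyl_L2 lam A (\<lambda>z. F (act (ginv g) z))"
      using is_weyl_L2_cong [of "conj_by (ginv g) (conj_by g A)" A] conj_ginv_conj
        fock_operatorD(5) [OF A [unfolded hilbert_schmidt_def, THEN conjunct1]] by simp
    then show False using False by blast
  qed
  with False show ?thesis by (simp add: weyl_L2_def)
qed

section \<open>The symbol as an integral\<close>

text \<open>Each coherent state contributes its scalar factor, one of them conjugated. The character
  and the central coordinate cancel, and the two quarters of |z0|^2 add up to the half.\<close>

lemma kernel_conj:
  assumes A: "fock_operator lam D A" and coh: "\<And>w. coherent lam w \<in> D"
  shows "kernel lam (conj_by (t, z0, c0) A) z w =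
    exp (- complex_of_real lam / 2 * (complex_of_real ((norm z0)\<^sup>2)
      + cdot z0 (vcnj (torus_act \<alpha> t w)) + cdot (torus_act \<alpha> t z) (vcnj z0)))
    * kernel lam A (act (t, z0, c0) z) (act (t, z0, c0) w)"
proof -
  let ?g = "(t, z0, c0)" and ?l = "complex_of_real lam"
  define a where "a w = \<i> * ?l * complex_of_real c0 - ?l / 4 * complex_of_real ((norm z0)\<^sup>2)
      - ?l / 2 * cdot z0 (vcnj (torus_act \<alpha> t w))" for w
  note A = fock_operatorD [OF A]
  have Uc: "U ?g (coherent lam w) = (\<lambda>x. (chi t * exp (a w)) * coherent lam (act ?g w) x)" for w
    unfolding a_def by (rule diamond_rep_coherent [OF lin])
  have cf: "coherent lam w \<in> fock lam" for w :: "complex^'n"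
    using A(1) coh [of w] by (rule subsetD)
  have UD: "U ?g (coherent lam w) \<in> D" unfolding Uc by (rule A(4) [OF coh])
  have "kernel lam (conj_by ?g A) z w =
      fock_inner lam (U ?g (conj_by ?g A (coherent lam w))) (U ?g (coherent lam z))"
    unfolding kernel_def conj_eq [of A, OF A(5) [OF UD]]
    by (rule inner_U [OF fock_U [OF A(5) [OF UD]] cf, symmetric])
  also have "\<dots> = (chi t * exp (a w)) * cnj (chi t * exp (a z)) *
      kernel lam A (act ?g z) (act ?g w)"
    unfolding U_conj [of A, OF A(5) [OF UD]] unfolding Uc A(7) [OF coh]
      fock_inner_scale_left fock_inner_scale_right kernel_def by (simp only: mult.assoc)
  also have "(chi t * exp (a w)) * cnj (chi t * exp (a z)) = (chi t * cnj (chi t)) * exp (a w + cnj (a z))"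
    by (simp only: complex_cnj_mult exp_cnj exp_add mult_ac)
  also have "chi t * cnj (chi t) = 1" by (simp add: mult_cnj_cmod norm_chi)
  also have "a w + cnj (a z) = - ?l / 2 * (complex_of_real ((norm z0)\<^sup>2)
      + cdot z0 (vcnj (torus_act \<alpha> t w)) + cdot (torus_act \<alpha> t z) (vcnj z0))"
    unfolding a_def complex_cnj_add complex_cnj_diff complex_cnj_mult complex_cnj_divide cnj_cdot_vcnj
    by (simp add: field_simps)
  finally show ?thesis by (simp only: mult_1)
qed

text \<open>With p = t.z and q = t.w, the factor from \<open>kernel_conj\<close> at (z + w, z - w)
  consists exactly of the cross terms by which the Gaussian at (p + z0, q) differs from the one at
  (p, q); the latter equals the one at (z, w) by unitarity of the torus action.\<close>

lemma weyl_integrand_conj: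
  assumes A: "fock_operator lam D A" and coh: "\<And>w. coherent lam w \<in> D"
  shows "weyl_integrand lam (conj_by (t, z0, c0) A) z w =
    weyl_integrand lam A (act (t, z0, c0) z) (torus_act \<alpha> t w)"
proof -
  let ?l = "complex_of_real lam"
  define p q where "p = torus_act \<alpha> t z" and "q = torus_act \<alpha> t w"
  have pq: "act (t, z0, c0) (z + w) = (p + z0) + q" "act (t, z0, c0) (z - w) = (p + z0) - q"
    "act (t, z0, c0) z = p + z0"
    by (simp_all add: diamond_act_def p_def q_def torus_act_plus torus_act_minus)
  have inv: "cdot z (vcnj z) = cdot p (vcnj p)" "cdot w (vcnj w) = cdot q (vcnj q)"
    "cdot z (vcnj w) = cdot p (vcnj q)" "cdot w (vcnj z) = cdot q (vcnj p)"
    by (simp_all only: p_def q_def cdot_torus_act_vcnj)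
  have "- ?l / 2 * (complex_of_real ((norm z0)\<^sup>2)
      + cdot z0 (vcnj (torus_act \<alpha> t (z - w))) + cdot (torus_act \<alpha> t (z + w)) (vcnj z0))
      + ?l / 2 * (- cdot z (vcnj z) - cdot w (vcnj w) + cdot z (vcnj w) - cdot (vcnj z) w)
    = ?l / 2 * (- cdot (p + z0) (vcnj (p + z0)) - cdot q (vcnj q) + cdot (p + z0) (vcnj q)
      - cdot (vcnj (p + z0)) q)"
    unfolding torus_act_plus torus_act_minus p_def [symmetric] q_def [symmetric]
      cdot_vcnj_left [of z w] cdot_vcnj_left [of "p + z0" q] inv vcnj_add vcnj_diff
      cdot_add_left cdot_add_right cdot_diff_right cdot_vcnj [of z0, symmetric]
    by (simp add: algebra_simps cdot_commute [of "vcnj _" q])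
  then show ?thesis
    unfolding weyl_integrand_def kernel_conj [OF A coh] pq q_def [symmetric]
    by (simp only: mult.assoc mult.left_commute [of _ "kernel _ _ _ _"] exp_add [symmetric])
qed

lemma weyl_converges_conj:
  assumes A: "weyl_converges lam D A"
  shows "weyl_converges lam (conj_dom lam \<alpha> chi g D) (conj_by g A)"
    and "weyl_integral lam (conj_by g A) z = weyl_integral lam A (act g z)"
proof -
  obtain t z0 c0 where g: "g = (t, z0, c0)" by (cases g)
  have op: "fock_operator lam D A" and coh: "\<And>w. coherent lam w \<in> D"
    and int: "\<And>z. integrable (mu lam) (weyl_integrand lam A z)"
    using A by (auto simp: weyl_converges_def)
  note A = fock_operatorD [OF op]
  \<comment> \<open>The zero translation only gives the integrand the shape \<open>T (w - v)\<close>
    of the invariance lemmas.\<close>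
  have W: "weyl_integrand lam (conj_by g A) z =
      (\<lambda>w. weyl_integrand lam A (act g z) (torus_act \<alpha> t (w - 0)))" for z
    unfolding g by (rule ext) (simp only: weyl_integrand_conj [OF op coh] diff_zero)
  have "coherent lam w \<in> conj_dom lam \<alpha> chi g D" for w
  proof -
    have "U g (coherent lam w) \<in> D"
      unfolding g diamond_rep_coherent [OF lin] by (rule A(4) [OF coh])
    then show ?thesis using A(1) coh by (auto simp: conj_dom_def)
  qed
  moreover have "integrable (mu lam) (weyl_integrand lam (conj_by g A) z)" for z
    unfolding W by (rule integrable_mu_torus_act [OF int])
  ultimately show "weyl_converges lam (conj_dom lam \<alpha> chi g D) (conj_by g A)"
    using fock_operator_conj [OF op] by (simp add: weyl_converges_def)
  have "weyl_integrand lam A (act g z) \<in> borel_measurable borel"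
    using borel_measurable_integrable [OF int] by simp
  then show "weyl_integral lam (conj_by g A) z = weyl_integral lam A (act g z)"
    unfolding weyl_integral_def W by (simp only: integral_mu_torus_act)
qed

end

text \<open>One conjunct for each way in which the symbol is defined: absolutely convergent
  integral, trace, and square-integrable extension. Each also asserts that the conjugated operator
  stays in its class, so that its symbol is meaningful.\<close>

theorem proposition5p3:
  fixes lam :: real
    and \<alpha> :: "'n::finite \<Rightarrow> real^'m::finite \<Rightarrow> real"
    and chi :: "real^'m \<Rightarrow> complex"
    and g :: "('m, 'n) diamond"
  assumes "lam > 0"
    and "\<And>k. linear (\<alpha> k)"
    and "unitary_character chi"
  shows "(\<forall>D A. weyl_converges lam D A \<longrightarrow>
            weyl_converges lam (conj_dom lam \<alpha> chi g D) (conj_op lam \<alpha> chi g A) \<and>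
            (\<forall>z. weyl_integral lam (conj_op lam \<alpha> chi g A) z =
                 weyl_integral lam A (diamond_act \<alpha> g z))) \<and>
         (\<forall>A. trace_class lam A \<longrightarrow>
            trace_class lam (conj_op lam \<alpha> chi g A) \<and>
            (\<forall>z. weyl_trace lam (conj_op lam \<alpha> chi g A) z =
                 weyl_trace lam A (diamond_act \<alpha> g z))) \<and>
         (\<forall>A. hilbert_schmidt lam A \<longrightarrow>
            hilbert_schmidt lam (conj_op lam \<alpha> chi g A) \<and>
            (AE z in mu lam. weyl_L2 lam (conj_op lam \<alpha> chi g A) z =
                 weyl_L2 lam A (diamond_act \<alpha> g z)))"
proof -
  interpret diamond_setting lam \<alpha> chi
    by (rule diamond_setting.intro [OF assms(2,3)])
  show ?thesis
    by (intro conjI allI impI)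
      (rule weyl_converges_conj trace_class_conj weyl_trace_conj hilbert_schmidt_conj weyl_L2_conj,
        assumption)+
qed

end
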